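(* For $n\ge 2$, consider the map sending $(a_1,\dots,a_n)\in\mathbb{C}^n$ to the first $n$ coefficients $(b_1,\dots,b_n)$ of the inverse $f^{-1}=1+\sum_{k\ge1}b_kX^k$ in the formal power series ring $\mathbb{C}[[X]]$ of $f=1-\sum_{i=1}^n a_iX^i$ (equivalently $b_0=1$, $b_k=\sum_{i=0}^{k-1}a_{k-i}b_i$). The bounded coefficient complexity of this map is greater than $\frac{1}{324}\,n\log n - O(n\log\log n)$.
   Context: All logarithms are to base 2. A circuit (straight-line program over $\mathbb{C}$) with inputs $a_1,\dots,a_n$ is a sequence of instructions, each forming $u\circ v$ with $\circ\in\{+,-,*\}$ from two previously computed values or inputs, or $\lambda u$ for a scalar $\lambda\in\mathbb{C}$; it computes a set of polynomials if they occur among the computed values; its size is its number of instructions. It is bounded coefficient (b.c.) if every scalar used has absolute value at most $2$. The bounded coefficient complexity of a set of polynomials is the minimal size of a b.c. circuit computing them. *)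

theory Defs
  imports Complex_Main "HOL-Computational_Algebra.Formal_Power_Series"
begin

text \<open>Polynomials in \<open>a\<^sub>1, \<dots>, a\<^sub>n\<close> over the infinite field of complex numbers are identified with the
  functions they induce on points \<open>a :: nat \<Rightarrow> complex\<close>, of which only the coordinates
  \<open>a 1, \<dots>, a n\<close> matter.\<close>

type_synonym cfun = "(nat \<Rightarrow> complex) \<Rightarrow> complex"

text \<open>An operand is a position in the list of all values available so far: with \<open>n\<close> inputs,
  positions \<open>0, \<dots>, n - 1\<close> hold the inputs \<open>a\<^sub>1, \<dots>, a\<^sub>n\<close>, and position \<open>n + j\<close> holds the result of
  the instruction with (0-based) number \<open>j\<close>.\<close>

datatype instr = Add nat nat | Sub nat nat | Mul nat nat | Scale complex nat

fun operands :: "instr \<Rightarrow> nat set" where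
  "operands (Add u v) = {u, v}"
| "operands (Sub u v) = {u, v}"
| "operands (Mul u v) = {u, v}"
| "operands (Scale c u) = {u}"

fun instr_value :: "cfun list \<Rightarrow> instr \<Rightarrow> cfun" where
  "instr_value vs (Add u v) = (\<lambda>a. (vs ! u) a + (vs ! v) a)"
| "instr_value vs (Sub u v) = (\<lambda>a. (vs ! u) a - (vs ! v) a)"
| "instr_value vs (Mul u v) = (\<lambda>a. (vs ! u) a * (vs ! v) a)"
| "instr_value vs (Scale c u) = (\<lambda>a. c * (vs ! u) a)"

definition input_values :: "nat \<Rightarrow> cfun list" where
  "input_values n = map (\<lambda>i a. a i) [1..<Suc n]"

definition circuit_values :: "nat \<Rightarrow> instr list \<Rightarrow> cfun list" where
  "circuit_values n P = foldl (\<lambda>vs ins. vs @ [instr_value vs ins]) (input_values n) P"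

definition circuit :: "nat \<Rightarrow> instr list \<Rightarrow> bool" where
  "circuit n P \<longleftrightarrow> (\<forall>j<length P. \<forall>u\<in>operands (P ! j). u < n + j)"

definition bounded_coefficient :: "instr list \<Rightarrow> bool" where
  "bounded_coefficient P \<longleftrightarrow> (\<forall>c u. Scale c u \<in> set P \<longrightarrow> norm c \<le> 2)"

text \<open>The inputs count as computed values, at no cost.\<close>

definition computes :: "nat \<Rightarrow> instr list \<Rightarrow> cfun set \<Rightarrow> bool" where
  "computes n P F \<longleftrightarrow> F \<subseteq> set (circuit_values n P)"

definition bc_complexity :: "nat \<Rightarrow> cfun set \<Rightarrow> nat" where
  "bc_complexity n F =
     (LEAST s. \<exists>P. circuit n P \<and> bounded_coefficient P \<and> computes n P F \<and> length P = s)"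

definition inversion_series :: "nat \<Rightarrow> (nat \<Rightarrow> complex) \<Rightarrow> complex fps" where
  "inversion_series n a = 1 - (\<Sum>i=1..n. fps_const (a i) * fps_X ^ i)"

definition inverse_coeff :: "nat \<Rightarrow> nat \<Rightarrow> cfun" where
  "inverse_coeff n k = (\<lambda>a. fps_nth (inverse (inversion_series n a)) k)"

lemma inversion_series_nth:
  "fps_nth (inversion_series n a) k = (if k = 0 then 1 else if k \<le> n then - a k else 0)"
proof -
  have "fps_nth (\<Sum>i=1..n. fps_const (a i) * fps_X ^ i) k = (\<Sum>i=1..n. if i = k then a k else 0)"
    unfolding fps_sum_nth by (rule sum.cong) (auto simp: fps_X_power_nth)
  also have "\<dots> = (if k \<in> {1..n} then a k else 0)"
    by (subst sum.delta) auto
  finally show ?thesis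
    by (auto simp: inversion_series_def)
qed

lemma inverse_coeff_0: "inverse_coeff n 0 a = 1"
  by (simp add: inverse_coeff_def inversion_series_nth)

lemma inverse_coeff_rec:
  assumes "1 \<le> k" "k \<le> n"
  shows "inverse_coeff n k a = (\<Sum>i<k. a (k - i) * inverse_coeff n i a)"
proof -
  let ?f = "inversion_series n a"
  have "inverse ?f * ?f = 1"
    by (rule inverse_mult_eq_1) (simp add: inversion_series_nth)
  hence "fps_nth (inverse ?f * ?f) k = 0"
    using assms by simp
  hence "(\<Sum>i=0..k. fps_nth (inverse ?f) i * fps_nth ?f (k - i)) = 0"
    by (simp add: fps_mult_nth)
  moreover have "{0..k} = insert k {..<k}"
    by auto
  ultimately have "fps_nth (inverse ?f) k
      + (\<Sum>i<k. fps_nth (inverse ?f) i * fps_nth ?f (k - i)) = 0"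
    by (simp add: inversion_series_nth)
  moreover have "(\<Sum>i<k. fps_nth (inverse ?f) i * fps_nth ?f (k - i))
      = - (\<Sum>i<k. a (k - i) * fps_nth (inverse ?f) i)"
    unfolding sum_negf[symmetric]
    by (rule sum.cong) (use assms in \<open>auto simp: inversion_series_nth\<close>)
  ultimately show ?thesis
    by (simp add: inverse_coeff_def)
qed

end

theory Submission
  imports Defs "Jordan_Normal_Form.Determinant" "HOL-Real_Asymp.Real_Asymp"
begin

text \<open>Circuits have no constants, so every computed value has zero constant term.  Hence the linear
  parts of the values form a linear circuit, and the quadratic parts arise from products of two
  linear parts.  The polarised quadratic part of \<open>b\<^sub>k\<close> is the convolution \<open>2 \<Sum>\<^bsub>i+l=k\<^esub> x\<^sub>i y\<^sub>l\<close>, so for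
  an \<open>N\<close>-periodic \<open>x\<close>, given by \<open>z \<in> \<complex>\<^sup>N\<close>, and \<open>y\<close> supported on \<open>{1..N}\<close> the outputs \<open>N < k \<le> 2N\<close> apply
  a circulant matrix with eigenvalues the Fourier coefficients of \<open>z\<close>.

  In a linear circuit with scalars of modulus at most \<open>2\<close>, every instruction at most doubles the
  largest minor (Morgenstern).  Used for the linear parts, this bounds volumes by \<open>2\<^sup>S\<close>; so Gram--Schmidt
  gives fewer than \<open>m = N/8\<close> directions modulo which all linear forms have length at most
  \<open>\<rho> = 2 \<cdot> 2\<^bsup>S/m\<^esup>\<close>.  A random sign vector projected away from these directions gives a \<open>z\<close> at which the
  linear forms have mean square \<open>O(\<rho>\<^sup>2)\<close>, while at least \<open>m\<close> eigenvalues have square modulus at least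
  \<open>N/8\<close>.  With \<open>x\<close> fixed, an \<open>m \<times> m\<close> minor uses only \<open>m\<close> of the multiplications, so by the inequality of
  arithmetic and geometric means they contribute only \<open>(1 + O(\<rho>\<^sup>2 S/m))\<^bsup>m/2\<^esup>\<close>.  Comparing with a minor of
  square modulus at least \<open>m!/2\<^sup>m\<close> gives \<open>S = \<Omega>(n log n)\<close>, with a constant
  better than \<open>1/324\<close>, so that the \<open>log log\<close> term is needed only for small \<open>n\<close>.\<close>

section \<open>Minors of orthonormal frames\<close>

definition ip :: "nat \<Rightarrow> (nat \<Rightarrow> complex) \<Rightarrow> (nat \<Rightarrow> complex) \<Rightarrow> complex" where
  "ip N u v = (\<Sum>l<N. u l * cnj (v l))"

definition orthonormal :: "nat \<Rightarrow> nat \<Rightarrow> (nat \<Rightarrow> nat \<Rightarrow> complex) \<Rightarrow> bool" where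
  "orthonormal N k e \<longleftrightarrow> (\<forall>a<k. \<forall>b<k. ip N (e a) (e b) = (if a = b then 1 else 0))"

text \<open>Rows are functions of the column index, so replacing a row is a function update and no
  matrix dimensions have to be carried along.\<close>

definition minor_det :: "nat \<Rightarrow> (nat \<Rightarrow> nat \<Rightarrow> complex) \<Rightarrow> complex" where
  "minor_det m A = det (mat m m (\<lambda>(i, j). A i j))"

lemma minor_det_expand:
  "minor_det m A = (\<Sum>p | p permutes {..<m}. signof p * (\<Prod>i<m. A i (p i)))"
proof -
  have "minor_det m A = (\<Sum>p | p permutes {0..<m}.
      signof p * (\<Prod>i = 0..<m. mat m m (\<lambda>(i, j). A i j) $$ (i, p i)))"
    unfolding minor_det_def by (subst det_def'[of _ m]) auto
  also have "\<dots> = (\<Sum>p | p permutes {0..<m}. signof p * (\<Prod>i = 0..<m. A i (p i)))"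
    by (intro sum.cong refl arg_cong2[where f = "(*)"] prod.cong) (auto dest: permutes_in_image)
  finally show ?thesis by (simp add: atLeast0LessThan)
qed

lemma minor_det_cong:
  assumes "\<And>i j. i < m \<Longrightarrow> j < m \<Longrightarrow> A i j = B i j"
  shows "minor_det m A = minor_det m B"
  unfolding minor_det_def by (rule arg_cong[where f = det]) (auto intro!: eq_matI assms)

lemma minor_det_row_combination:
  assumes "i < m"
  shows "minor_det m (A(i := \<lambda>b. c * u b + d * v b))
    = c * minor_det m (A(i := u)) + d * minor_det m (A(i := v))"
proof -
  have split: "(\<Prod>r<m. (A(i := w)) r (p r)) = w (p i) * (\<Prod>r\<in>{..<m} - {i}. A r (p r))" for w p
    using assms by (subst prod.remove[of _ i]) (auto intro!: prod.cong)
  show ?thesis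
    unfolding minor_det_expand split
    by (simp add: sum_distrib_left flip: sum.distrib) (simp add: algebra_simps)
qed

lemma minor_det_identical_rows:
  assumes "i < m" "j < m" "i \<noteq> j" "A i = A j"
  shows "minor_det m A = 0"
  unfolding minor_det_def
  by (rule det_identical_rows[of _ m i j]) (use assms in auto)

lemma minor_det_lower_triangular:
  assumes "\<And>i j. i < j \<Longrightarrow> j < m \<Longrightarrow> A i j = 0"
  shows "minor_det m A = (\<Prod>i<m. A i i)"
proof -
  have "minor_det m A = prod_list (diag_mat (mat m m (\<lambda>(i, j). A i j)))"
    unfolding minor_det_def by (rule det_lower_triangular[of m]) (use assms in auto)
  also have "\<dots> = (\<Prod>i<m. A i i)"
    unfolding diag_mat_def by (subst prod.list_conv_set_nth) (simp add: atLeast0LessThan)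
  finally show ?thesis .
qed

lemma minor_det_scale_columns:
  "minor_det m (\<lambda>a b. c b * A a b) = (\<Prod>b<m. c b) * minor_det m A"
proof -
  have "(\<Prod>a<m. c (p a) * A a (p a)) = (\<Prod>b<m. c b) * (\<Prod>a<m. A a (p a))"
    if "p permutes {..<m}" for p
    unfolding prod.distrib using prod.permute[OF that, of c] by (simp add: o_def)
  thus ?thesis
    unfolding minor_det_expand sum_distrib_left
    by (intro sum.cong refl) (simp add: mult_ac)
qed

lemma norm_minor_det_permute_rows:
  assumes "p permutes {..<m}"
  shows "norm (minor_det m (\<lambda>a. A (p a))) = norm (minor_det m A)"
proof -
  have p: "p permutes {0..<m}" using assms by (simp add: atLeast0LessThan)
  have "minor_det m (\<lambda>a. A (p a))
      = det (mat m m (\<lambda>(i, j). mat m m (\<lambda>(i, j). A i j) $$ (p i, j)))"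
    unfolding minor_det_def
    by (rule arg_cong[where f = det], rule eq_matI) (use permutes_in_image[OF p] in auto)
  also have "\<dots> = signof p * minor_det m A"
    unfolding minor_det_def by (rule det_permute_rows[OF _ p]) auto
  finally show ?thesis by (simp add: norm_mult sign_def)
qed

text \<open>The Cauchy--Binet formula, with every minor counted once for each ordering of its rows.\<close>

lemma sum_norm_minor_det_squared:
  assumes "orthonormal N m e"
  shows "(\<Sum>l\<in>{..<m} \<rightarrow>\<^sub>E {..<N}. (norm (minor_det m (\<lambda>a b. e b (l a))))\<^sup>2) = fact m"
proof -
  let ?P = "{p. p permutes {..<m}}"
  have inner: "(\<Prod>a<m. ip N (e (p a)) (e (q a))) = (if p = q then 1 else 0)"
    if "p \<in> ?P" "q \<in> ?P" for p q
  proof (cases "p = q")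
    case True
    thus ?thesis using that assms by (auto simp: orthonormal_def permutes_in_image[of _ "{..<m}", simplified]
      intro!: prod.neutral dest: permutes_in_image)
  next
    case False
    then obtain a where a: "p a \<noteq> q a" by auto
    hence "a < m" using that by (metis lessThan_iff mem_Collect_eq permutes_not_in)
    moreover from this have "p a < m" "q a < m"
      using that permutes_in_image[of p "{..<m}" a] permutes_in_image[of q "{..<m}" a] by auto
    ultimately have "ip N (e (p a)) (e (q a)) = 0" "a \<in> {..<m}"
      using a assms by (auto simp: orthonormal_def)
    hence "(\<Prod>a<m. ip N (e (p a)) (e (q a))) = 0" by (intro prod_zero) auto
    with False show ?thesis by simp
  qed
  have "of_real (\<Sum>l\<in>{..<m} \<rightarrow>\<^sub>E {..<N}. (norm (minor_det m (\<lambda>a b. e b (l a))))\<^sup>2)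
      = (\<Sum>l\<in>{..<m} \<rightarrow>\<^sub>E {..<N}. minor_det m (\<lambda>a b. e b (l a)) * cnj (minor_det m (\<lambda>a b. e b (l a))))"
    by (simp add: complex_norm_square del: of_real_power)
  also have "\<dots> = (\<Sum>l\<in>{..<m} \<rightarrow>\<^sub>E {..<N}. \<Sum>p\<in>?P. \<Sum>q\<in>?P.
      signof p * signof q * (\<Prod>a<m. e (p a) (l a) * cnj (e (q a) (l a))))"
    unfolding minor_det_expand cnj_sum sum_product
    by (intro sum.cong refl) (auto simp: sign_def prod.distrib)
  also have "\<dots> = (\<Sum>p\<in>?P. \<Sum>q\<in>?P. \<Sum>l\<in>{..<m} \<rightarrow>\<^sub>E {..<N}.
      signof p * signof q * (\<Prod>a<m. e (p a) (l a) * cnj (e (q a) (l a))))"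
    by (rule trans[OF sum.swap sum.cong[OF refl sum.swap]])
  also have "\<dots> = (\<Sum>p\<in>?P. \<Sum>q\<in>?P. signof p * signof q * (\<Prod>a<m. ip N (e (p a)) (e (q a))))"
    by (intro sum.cong refl)
       (simp add: ip_def prod_sum_PiE[of "{..<m}" "\<lambda>_. {..<N}"] flip: sum_distrib_left)
  also have "\<dots> = (\<Sum>p\<in>?P. \<Sum>q\<in>?P. if p = q then 1 else 0)"
    by (intro sum.cong refl) (subst inner, auto simp: sign_def)
  also have "\<dots> = (\<Sum>p\<in>?P. 1)"
    by (intro sum.cong refl) (simp add: finite_permutations)
  also have "\<dots> = of_real (fact m)"
    by (simp add: card_permutations)
  finally show ?thesis by (simp only: of_real_eq_iff)
qed

text \<open>Averaging: there are \<open>N ^ m\<close> row selections and their squared minors sum to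
  \<open>fact m\<close>, so some selection reaches the mean.\<close>

lemma large_minor_det:
  assumes "orthonormal N m e"
  obtains l where "\<And>a. a < m \<Longrightarrow> l a < N"
    "fact m \<le> real N ^ m * (norm (minor_det m (\<lambda>a b. e b (l a))))\<^sup>2"
proof -
  let ?L = "{..<m} \<rightarrow>\<^sub>E {..<N}"
  let ?d = "\<lambda>l. (norm (minor_det m (\<lambda>a b. e b (l a))))\<^sup>2"
  have "\<exists>l\<in>?L. fact m \<le> real N ^ m * ?d l"
  proof (rule ccontr)
    assume "\<not> ?thesis"
    hence less: "real N ^ m * ?d l < fact m" if "l \<in> ?L" for l
      using that by force
    \<comment> \<open>An empty index set would make the sum of squares 0, but it equals
      \<open>fact m\<close>.\<close>
    have "?L \<noteq> {}"
      using sum_norm_minor_det_squared[OF assms] by (auto simp del: PiE_eq_empty_iff)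
    hence "(\<Sum>l\<in>?L. real N ^ m * ?d l) < (\<Sum>l\<in>?L. fact m)"
      by (intro sum_strict_mono less) (auto intro!: finite_PiE)
    thus False
      using sum_norm_minor_det_squared[OF assms]
      by (simp add: card_PiE flip: sum_distrib_left)
  qed
  thus ?thesis using that by (auto simp: PiE_iff)
qed

text \<open>All \<open>fact m\<close> orderings of an injective selection have the same squared
  minor, and together they are only part of a sum equal to \<open>fact m\<close>.\<close>

lemma norm_minor_det_le_1:
  assumes "orthonormal N m e" "\<And>a. a < m \<Longrightarrow> l a < N"
  shows "norm (minor_det m (\<lambda>a b. e b (l a))) \<le> 1"
proof (cases "inj_on l {..<m}")
  case False
  then obtain i j where "i < m" "j < m" "i \<noteq> j" "l i = l j" by (auto simp: inj_on_def)
  thus ?thesis by (subst minor_det_identical_rows[of i m j]) auto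
next
  case True
  let ?P = "{p. p permutes {..<m}}"
  let ?d = "\<lambda>l. (norm (minor_det m (\<lambda>a b. e b (l a))))\<^sup>2"
  \<comment> \<open>The restriction makes every reordering an element of the extensional function
    space over which the sum runs.\<close>
  let ?r = "\<lambda>p. restrict (l \<circ> p) {..<m}"
  have restr: "?d (?r p) = ?d l" if "p \<in> ?P" for p
  proof -
    have "minor_det m (\<lambda>a b. e b (?r p a)) = minor_det m (\<lambda>a b. e b (l (p a)))"
      by (rule minor_det_cong) simp
    thus ?thesis using norm_minor_det_permute_rows[of p m "\<lambda>a b. e b (l a)"] that by simp
  qed
  have inj: "inj_on ?r ?P"
  proof (rule inj_onI, rule ext)
    fix p q a assume pq: "p \<in> ?P" "q \<in> ?P" and eq: "?r p = ?r q"
    show "p a = q a"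
    proof (cases "a < m")
      case True
      hence "l (p a) = l (q a)" using fun_cong[OF eq, of a] by simp
      moreover have "p a < m" "q a < m"
        using True pq permutes_in_image[of p "{..<m}" a] permutes_in_image[of q "{..<m}" a] by auto
      ultimately show ?thesis using \<open>inj_on l {..<m}\<close> by (auto simp: inj_on_def)
    next
      case False
      thus ?thesis using pq by (auto simp: permutes_def)
    qed
  qed
  have sub: "?r ` ?P \<subseteq> {..<m} \<rightarrow>\<^sub>E {..<N}"
  proof (clarsimp simp: PiE_iff)
    fix p i assume "p permutes {..<m}" "i < m"
    hence "p i < m" using permutes_in_image[of p "{..<m}" i] by auto
    thus "l (p i) < N" by (rule assms(2))
  qed
  have "fact m * ?d l = (\<Sum>p\<in>?P. ?d (?r p))"
    by (subst sum.cong[OF refl restr]) (auto simp: card_permutations)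
  also have "\<dots> = (\<Sum>l'\<in>?r ` ?P. ?d l')"
    by (subst sum.reindex[OF inj]) (simp add: o_def)
  also have "\<dots> \<le> (\<Sum>l'\<in>{..<m} \<rightarrow>\<^sub>E {..<N}. ?d l')"
    by (rule sum_mono2[OF _ sub]) (auto intro!: finite_PiE)
  also have "\<dots> = fact m" by (rule sum_norm_minor_det_squared[OF assms(1)])
  finally have "?d l \<le> 1" by simp
  thus ?thesis by (simp add: power2_le_iff_abs_le abs_square_le_1)
qed

section \<open>Gram--Schmidt orthogonalisation\<close>

definition sqnorm :: "nat \<Rightarrow> (nat \<Rightarrow> complex) \<Rightarrow> real" where
  "sqnorm N u = (\<Sum>l<N. (norm (u l))\<^sup>2)"

text \<open>For orthonormal \<open>e\<close> this is the orthogonal projection onto the complement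
  of the span of the first \<open>k\<close> frame vectors.\<close>

definition proj_off :: "nat \<Rightarrow> nat \<Rightarrow> (nat \<Rightarrow> nat \<Rightarrow> complex) \<Rightarrow> (nat \<Rightarrow> complex) \<Rightarrow> nat \<Rightarrow> complex" where
  "proj_off N k e u l = u l - (\<Sum>b<k. ip N u (e b) * e b l)"

lemma ip_cnj: "cnj (ip N u v) = ip N v u"
  by (simp add: ip_def mult.commute)

lemma ip_self: "ip N u u = of_real (sqnorm N u)"
  by (simp add: ip_def sqnorm_def complex_norm_square del: of_real_power)

lemma sqnorm_nonneg: "sqnorm N u \<ge> 0"
  by (simp add: sqnorm_def sum_nonneg)

lemma ip_scale_left: "ip N (\<lambda>l. c * u l) v = c * ip N u v"
  by (simp add: ip_def sum_distrib_left mult.assoc)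

lemma ip_scale_right: "ip N u (\<lambda>l. c * v l) = cnj c * ip N u v"
  by (simp add: ip_def sum_distrib_left mult_ac)

lemma ip_proj_off_left: "ip N (proj_off N k e u) v = ip N u v - (\<Sum>b<k. ip N u (e b) * ip N (e b) v)"
proof -
  have "ip N (proj_off N k e u) v
      = ip N u v - (\<Sum>l<N. \<Sum>b<k. ip N u (e b) * e b l * cnj (v l))"
    unfolding ip_def[of N _ v] proj_off_def
    by (simp add: left_diff_distrib sum_subtractf sum_distrib_right)
  also have "(\<Sum>l<N. \<Sum>b<k. ip N u (e b) * e b l * cnj (v l))
      = (\<Sum>b<k. ip N u (e b) * ip N (e b) v)"
    unfolding ip_def[of N _ v] by (subst sum.swap) (simp add: sum_distrib_left mult.assoc)
  finally show ?thesis .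
qed

text \<open>Self-adjointness of the projection: the expansion in \<open>ip_proj_off_left\<close> is
  Hermitian in its two arguments.\<close>

lemma ip_proj_off_right: "ip N u (proj_off N k e v) = ip N (proj_off N k e u) v"
proof -
  have "ip N u (proj_off N k e v) = cnj (ip N (proj_off N k e v) u)" by (simp add: ip_cnj)
  also have "\<dots> = ip N (proj_off N k e u) v"
    unfolding ip_proj_off_left by (simp add: ip_cnj mult.commute)
  finally show ?thesis .
qed

lemma ip_proj_off_frame:
  assumes "orthonormal N k e" "b < k"
  shows "ip N (proj_off N k e u) (e b) = 0"
proof -
  have "(\<Sum>b'<k. ip N u (e b') * ip N (e b') (e b)) = (\<Sum>b'<k. if b' = b then ip N u (e b) else 0)"
    by (intro sum.cong refl) (use assms in \<open>auto simp: orthonormal_def\<close>)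
  thus ?thesis using assms(2) by (simp add: ip_proj_off_left)
qed

lemma ip_proj_off_self:
  assumes "orthonormal N k e"
  shows "ip N (proj_off N k e u) u = of_real (sqnorm N (proj_off N k e u))"
proof -
  let ?p = "proj_off N k e u"
  have "ip N ?p u = ip N (proj_off N k e ?p) u"
  proof -
    have "ip N (proj_off N k e ?p) u = ip N ?p u - (\<Sum>b<k. ip N ?p (e b) * ip N (e b) u)"
      by (rule ip_proj_off_left)
    also have "(\<Sum>b<k. ip N ?p (e b) * ip N (e b) u) = 0"
      by (intro sum.neutral) (simp add: ip_proj_off_frame[OF assms])
    finally show ?thesis by simp
  qed
  also have "\<dots> = ip N ?p ?p" by (simp add: ip_proj_off_right)
  finally show ?thesis by (simp add: ip_self)
qed

lemma sqnorm_proj_off: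
  assumes "orthonormal N k e"
  shows "sqnorm N (proj_off N k e u) = sqnorm N u - (\<Sum>b<k. (norm (ip N u (e b)))\<^sup>2)"
proof -
  have "of_real (sqnorm N (proj_off N k e u)) = ip N (proj_off N k e u) u"
    by (rule ip_proj_off_self[OF assms, symmetric])
  also have "\<dots> = ip N u u - (\<Sum>b<k. ip N u (e b) * cnj (ip N u (e b)))"
    by (simp add: ip_proj_off_left ip_cnj)
  also have "\<dots> = complex_of_real (sqnorm N u - (\<Sum>b<k. (norm (ip N u (e b)))\<^sup>2))"
    by (simp add: ip_self complex_norm_square del: of_real_power)
  finally show ?thesis by (simp only: of_real_eq_iff)
qed

lemma sqnorm_proj_off_le:
  assumes "orthonormal N k e"
  shows "sqnorm N (proj_off N k e u) \<le> sqnorm N u"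
  by (simp add: sqnorm_proj_off[OF assms] sum_nonneg)

text \<open>Each selected vector contributes a factor larger than \<open>\<rho>\<close> to a triangular determinant, so
  Gram--Schmidt orthogonalisation must stop before \<open>m\<close> steps.\<close>

lemma gram_schmidt_selection:
  assumes vol: "\<And>e u. orthonormal N m e \<Longrightarrow> (\<And>a. a < m \<Longrightarrow> u a \<in> U) \<Longrightarrow>
      norm (minor_det m (\<lambda>a b. ip N (e b) (u a))) \<le> B"
    and "\<rho> \<ge> 0" "B < \<rho> ^ m"
  obtains k e where "k < m" "orthonormal N k e"
    "\<And>u. u \<in> U \<Longrightarrow> sqnorm N (proj_off N k e u) \<le> \<rho>\<^sup>2"
proof (rule ccontr)
  note stop = that
  assume not: "\<not> thesis"
  \<comment> \<open>The invariant describes a triangular system with large diagonal. Its last clause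
    puts every chosen \<open>u a\<close> in the span of the frame, so that the next frame vector is
    orthogonal to it and triangularity persists.\<close>
  define good where "good k e u \<longleftrightarrow> orthonormal N k e \<and> (\<forall>a<k. u a \<in> U)
      \<and> (\<forall>a b. a < b \<and> b < k \<longrightarrow> ip N (e b) (u a) = 0)
      \<and> (\<forall>a<k. norm (ip N (e a) (u a)) \<ge> \<rho>)
      \<and> (\<forall>a<k. \<forall>l<N. proj_off N k e (u a) l = 0)" for k e u
  have "\<exists>e u. good k e u"
    if "k \<le> m" for k
    using that
  proof (induction k)
    case 0
    show ?case by (simp add: good_def orthonormal_def)
  next
    case (Suc k)
    hence "k \<le> m" by simp
    from Suc.IH[OF this] obtain e u where good: "good k e u" by blast
    have e: "orthonormal N k e" and u: "\<And>a. a < k \<Longrightarrow> u a \<in> U"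
      and tri: "\<And>a b. a < b \<Longrightarrow> b < k \<Longrightarrow> ip N (e b) (u a) = 0"
      and diag: "\<And>a. a < k \<Longrightarrow> norm (ip N (e a) (u a)) \<ge> \<rho>"
      and span: "\<And>a l. a < k \<Longrightarrow> l < N \<Longrightarrow> proj_off N k e (u a) l = 0" using good by (auto simp: good_def)
    obtain w where w: "w \<in> U" "sqnorm N (proj_off N k e w) > \<rho>\<^sup>2"
      using not stop[OF _ e] Suc.prems by (meson Suc_le_lessD not_le)
    define s where "s = sqrt (sqnorm N (proj_off N k e w))"
    have s2: "sqnorm N (proj_off N k e w) = s\<^sup>2"
      by (simp add: s_def sqnorm_nonneg)
    have s: "s > 0" "s \<ge> \<rho>"
      using w(2) unfolding s_def
      by (simp_all add: real_le_rsqrt order.strict_trans1[OF zero_le_power2 w(2)])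
    \<comment> \<open>The new frame vector is the normalised residual of \<open>w\<close>; the new
      diagonal entry \<open>ip N h w\<close> is then its length \<open>s\<close>, which is at least
      \<rho>.\<close>
    define h where "h = (\<lambda>l. complex_of_real (1 / s) * proj_off N k e w l)"
    define e' where "e' = e(k := h)"
    define u' where "u' = u(k := w)"
    have hh: "ip N h h = 1"
      using s unfolding h_def ip_scale_left ip_scale_right ip_self s2
      by (simp add: power2_eq_square)
    have he: "ip N h (e b) = 0" if "b < k" for b
      unfolding h_def ip_scale_left using ip_proj_off_frame[OF e that] by simp
    have eh: "ip N (e b) h = 0" if "b < k" for b
      using he[OF that] ip_cnj[of N h "e b"] by simp
    have hw: "ip N h w = of_real s"
      unfolding h_def ip_scale_left ip_proj_off_self[OF e] s2
      using s by (simp add: power2_eq_square)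
    have wh: "ip N w h = of_real s" using hw ip_cnj[of N h w] by simp
    have hu: "ip N h (u a) = 0" if "a < k" for a
    proof -
      have "ip N (proj_off N k e w) (u a) = ip N w (proj_off N k e (u a))"
        by (simp add: ip_proj_off_right)
      also have "\<dots> = 0" by (simp add: ip_def span[OF that])
      finally show ?thesis unfolding h_def ip_scale_left by simp
    qed
    have uh: "ip N (u a) h = 0" if "a < k" for a
      using hu[OF that] ip_cnj[of N h "u a"] by simp
    have proj: "proj_off N (Suc k) e' v l = proj_off N k e v l - ip N v h * h l" for v l
      by (simp add: proj_off_def e'_def)
    have "orthonormal N (Suc k) e'"
      using e hh he eh by (auto simp: orthonormal_def e'_def less_Suc_eq)
    moreover have "\<forall>a<Suc k. u' a \<in> U"
      using u w by (auto simp: u'_def)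
    moreover have "\<forall>a b. a < b \<and> b < Suc k \<longrightarrow> ip N (e' b) (u' a) = 0"
      using tri hu by (auto simp: u'_def e'_def less_Suc_eq)
    moreover have "\<forall>a<Suc k. norm (ip N (e' a) (u' a)) \<ge> \<rho>"
      using diag hw s by (auto simp: u'_def e'_def less_Suc_eq)
    moreover have "\<forall>a<Suc k. \<forall>l<N. proj_off N (Suc k) e' (u' a) l = 0"
    proof (intro allI impI)
      fix a l assume al: "a < Suc k" "l < N"
      show "proj_off N (Suc k) e' (u' a) l = 0"
      proof (cases "a = k")
        case True
        have "proj_off N (Suc k) e' w l = proj_off N k e w l - of_real s * h l"
          by (simp only: proj wh)
        also have "of_real s * h l = proj_off N k e w l"
          using s by (simp add: h_def)
        finally show ?thesis using True by (simp add: u'_def)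
      next
        case False
        thus ?thesis using al span uh unfolding proj by (simp add: u'_def)
      qed
    qed
    ultimately have "good (Suc k) e' u'" by (simp only: good_def)
    thus ?case by blast
  qed
  from this[OF order_refl] obtain e u where good: "good m e u" by blast
  have e: "orthonormal N m e" and u: "\<And>a. a < m \<Longrightarrow> u a \<in> U"
    and tri: "\<And>a b. a < b \<Longrightarrow> b < m \<Longrightarrow> ip N (e b) (u a) = 0"
    and diag: "\<And>a. a < m \<Longrightarrow> norm (ip N (e a) (u a)) \<ge> \<rho>" using good by (auto simp: good_def)
  have "\<rho> ^ m = (\<Prod>a<m. \<rho>)" by simp
  also have "\<dots> \<le> (\<Prod>a<m. norm (ip N (e a) (u a)))"
    using diag \<open>\<rho> \<ge> 0\<close> by (intro prod_mono) auto
  also have "\<dots> = norm (minor_det m (\<lambda>a b. ip N (e b) (u a)))"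
    using tri by (subst minor_det_lower_triangular) (auto simp: prod_norm)
  also have "\<dots> \<le> B" by (rule vol[OF e u])
  finally show False using assms(3) by simp
qed

section \<open>Determinants of row systems\<close>

text \<open>This is Morgenstern's measure of a set of rows: a bound for all \<open>m\<close> by
  \<open>m\<close> minors with rows taken from it.\<close>

definition volbound :: "nat \<Rightarrow> (nat \<Rightarrow> complex) set \<Rightarrow> real \<Rightarrow> bool" where
  "volbound m X B \<longleftrightarrow> (\<forall>f. (\<forall>a<m. f a \<in> X) \<longrightarrow> norm (minor_det m f) \<le> B)"

lemma volboundD: "volbound m X B \<Longrightarrow> (\<And>a. a < m \<Longrightarrow> f a \<in> X) \<Longrightarrow> norm (minor_det m f) \<le> B"
  by (auto simp: volbound_def)

lemma volbound_mono: "volbound m X B \<Longrightarrow> Y \<subseteq> X \<Longrightarrow> B \<le> B' \<Longrightarrow> volbound m Y B'"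
  by (fastforce simp: volbound_def)

lemma volbound_nonneg: "volbound m X B \<Longrightarrow> u \<in> X \<Longrightarrow> 0 \<le> B"
  by (rule order_trans[OF norm_ge_zero volboundD[of m X B "\<lambda>_. u"]])

text \<open>A minor in which the new row occurs twice vanishes. If it occurs once, linearity in that
  row gives the factor \<open>norm c + norm d\<close>; the condition \<open>1 \<le> K\<close> covers
  minors without the new row.\<close>

lemma volbound_insert_combination:
  assumes "volbound m X B" "u \<in> X" "v \<in> X" "norm c + norm d \<le> K" "1 \<le> K"
  shows "volbound m (insert (\<lambda>b. c * u b + d * v b) X) (K * B)"
  unfolding volbound_def
proof (intro allI impI)
  fix f assume f: "\<forall>a<m. f a \<in> insert (\<lambda>b. c * u b + d * v b) X"
  let ?w = "\<lambda>b. c * u b + d * v b"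
  have B: "0 \<le> B" by (rule volbound_nonneg[OF assms(1,2)])
  show "norm (minor_det m f) \<le> K * B"
  proof (cases "\<forall>a<m. f a \<in> X")
    case True
    hence "norm (minor_det m f) \<le> 1 * B" using volboundD[OF assms(1)] by simp
    also have "\<dots> \<le> K * B" using assms(5) B by (intro mult_right_mono)
    finally show ?thesis .
  next
    case False
    then obtain i where i: "i < m" "f i \<notin> X" by auto
    hence fi: "f i = ?w" using f by auto
    show ?thesis
    proof (cases "\<exists>j<m. j \<noteq> i \<and> f j \<notin> X")
      case True
      then obtain j where "j < m" "j \<noteq> i" "f j = f i" using f fi by auto
      thus ?thesis using minor_det_identical_rows[of j m i f] i B assms(5) by simp
    next
      case False
      have "f = f(i := ?w)" using fi by auto
      hence "minor_det m f = c * minor_det m (f(i := u)) + d * minor_det m (f(i := v))"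
        using minor_det_row_combination[OF i(1), of f c u d v] by simp
      hence "norm (minor_det m f)
          \<le> norm c * norm (minor_det m (f(i := u))) + norm d * norm (minor_det m (f(i := v)))"
        by (metis norm_mult norm_triangle_ineq)
      also have "\<dots> \<le> norm c * B + norm d * B"
        using False assms by (intro add_mono mult_left_mono volboundD[OF assms(1)]) auto
      also have "\<dots> \<le> K * B"
        using mult_right_mono[OF assms(4) B] by (simp add: distrib_right)
      finally show ?thesis .
    qed
  qed
qed

text \<open>Expanding one row of \<open>T\<close> at a time by multilinearity costs one factor
  \<open>norm (c a) + norm (d a)\<close> per row.\<close>

lemma norm_minor_det_row_combinations:
  assumes "finite T" "T \<subseteq> {..<m}" "volbound m X B"
    and "\<And>a. a < m \<Longrightarrow> a \<notin> T \<Longrightarrow> f a \<in> X"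
    and "\<And>a. a \<in> T \<Longrightarrow> u a \<in> X" "\<And>a. a \<in> T \<Longrightarrow> v a \<in> X"
    and "\<And>a. a \<in> T \<Longrightarrow> f a = (\<lambda>b. c a * u a b + d a * v a b)"
  shows "norm (minor_det m f) \<le> B * (\<Prod>a\<in>T. norm (c a) + norm (d a))"
  using assms
proof (induction T arbitrary: f rule: finite_induct)
  case empty
  thus ?case using volboundD[of m X B f] by simp
next
  case (insert i T)
  let ?r = "\<lambda>a. norm (c a) + norm (d a)"
  let ?R = "B * (\<Prod>a\<in>T. ?r a)"
  have i: "i < m" using insert.prems by simp
  have "f = f(i := \<lambda>b. c i * u i b + d i * v i b)" using insert.prems(6)[of i] by auto
  hence "minor_det m f = c i * minor_det m (f(i := u i)) + d i * minor_det m (f(i := v i))"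
    using minor_det_row_combination[OF i, of f "c i" "u i" "d i" "v i"] by simp
  hence "norm (minor_det m f)
      \<le> norm (c i) * norm (minor_det m (f(i := u i))) + norm (d i) * norm (minor_det m (f(i := v i)))"
    by (metis norm_mult norm_triangle_ineq)
  also have "\<dots> \<le> norm (c i) * ?R + norm (d i) * ?R"
    using insert.prems insert.hyps by (intro add_mono mult_left_mono insert.IH) auto
  also have "\<dots> = B * (\<Prod>a\<in>insert i T. ?r a)"
    using insert.hyps by (simp add: algebra_simps)
  finally show ?case .
qed

text \<open>The inequality of arithmetic and geometric means, obtained by multiplying the tangent
  bounds \<open>x \<le> L * exp (x / L - 1)\<close>.\<close>

lemma prod_le_mean_power:
  fixes x :: "'a \<Rightarrow> real"
  assumes "\<And>a. a \<in> A \<Longrightarrow> 0 \<le> x a" "(\<Sum>a\<in>A. x a) \<le> real (card A) * L" "L > 0"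
  shows "(\<Prod>a\<in>A. x a) \<le> L ^ card A"
proof (cases "finite A")
  case True
  have "(\<Prod>a\<in>A. x a) \<le> (\<Prod>a\<in>A. L * exp (x a / L - 1))"
  proof (intro prod_mono conjI)
    fix a assume "a \<in> A"
    have "L * (x a / L) \<le> L * exp (x a / L - 1)"
      using exp_ge_add_one_self[of "x a / L - 1"] assms(3) by (intro mult_left_mono) auto
    thus "x a \<le> L * exp (x a / L - 1)" using assms(3) by simp
  qed (use assms in auto)
  also have "\<dots> = L ^ card A * exp (\<Sum>a\<in>A. x a / L - 1)"
    using True by (simp add: prod.distrib exp_sum)
  also have "(\<Sum>a\<in>A. x a / L - 1) = (\<Sum>a\<in>A. x a) / L - real (card A)"
    by (simp add: sum_subtractf sum_divide_distrib)
  also have "L ^ card A * exp ((\<Sum>a\<in>A. x a) / L - real (card A)) \<le> L ^ card A * 1"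
    using assms(2,3) by (intro mult_left_mono) (auto simp: field_simps)
  finally show ?thesis by simp
qed auto

text \<open>Adjoining the rows one by one would cost a factor for each of them. A nonzero minor has
  distinct rows, so it uses every adjoined row at most once and at most \<open>m\<close> of them in
  all; the mean inequality then bounds the product of their weights by the total square
  weight.\<close>

lemma volbound_products:
  assumes vol: "volbound m X B" and K: "finite K" and m: "m > 0"
    and uv: "\<And>i. i \<in> K \<Longrightarrow> u i \<in> X" "\<And>i. i \<in> K \<Longrightarrow> v i \<in> X"
    and L: "real m + (\<Sum>i\<in>K. (norm (c i) + norm (d i))\<^sup>2) \<le> real m * L"
    and x: "x \<in> X"
  shows "volbound m (X \<union> (\<lambda>i b. c i * u i b + d i * v i b) ` K) (B * sqrt L ^ m)"
  unfolding volbound_def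
proof (intro allI impI)
  let ?g = "\<lambda>i b. c i * u i b + d i * v i b"
  let ?r = "\<lambda>i. norm (c i) + norm (d i)"
  fix f assume f: "\<forall>a<m. f a \<in> X \<union> ?g ` K"
  have B: "0 \<le> B" using volbound_nonneg[OF vol x] .
  have L0: "L > 0"
  proof -
    have "0 \<le> (\<Sum>i\<in>K. (?r i)\<^sup>2)" by (rule sum_nonneg) auto
    hence "real m * L > 0" using L m by linarith
    thus ?thesis using m by (simp add: zero_less_mult_iff)
  qed
  show "norm (minor_det m f) \<le> B * sqrt L ^ m"
  proof (cases "inj_on f {..<m}")
    case False
    then obtain i j where "i < m" "j < m" "i \<noteq> j" "f i = f j" by (auto simp: inj_on_def)
    thus ?thesis using minor_det_identical_rows[of i m j f] B L0 by simp
  next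
    case True
    define T where "T = {a. a < m \<and> f a \<notin> X}"
    have T: "finite T" "T \<subseteq> {..<m}" by (auto simp: T_def)
    have "\<forall>a\<in>T. \<exists>i\<in>K. f a = ?g i" using f by (auto simp: T_def)
    hence "\<exists>\<kappa>. \<forall>a\<in>T. \<kappa> a \<in> K \<and> f a = ?g (\<kappa> a)"
      unfolding Bex_def by (rule bchoice)
    then obtain \<kappa> where "\<forall>a\<in>T. \<kappa> a \<in> K \<and> f a = ?g (\<kappa> a)" by (rule exE)
    hence \<kappa>: "\<And>a. a \<in> T \<Longrightarrow> \<kappa> a \<in> K" "\<And>a. a \<in> T \<Longrightarrow> f a = ?g (\<kappa> a)" by simp_all
    have inj: "inj_on \<kappa> T"
    proof (rule inj_onI)
      fix a b assume "a \<in> T" "b \<in> T" "\<kappa> a = \<kappa> b"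
      hence "f a = f b" using \<kappa>(2) by simp
      thus "a = b" using True \<open>a \<in> T\<close> \<open>b \<in> T\<close> by (auto simp: T_def inj_on_def)
    qed
    \<comment> \<open>Adding 1 to every square pads the product to all \<open>m\<close> rows without
      decreasing it, so the mean is taken over exactly \<open>m\<close> factors.\<close>
    define y where "y = (\<lambda>a. if a \<in> T then 1 + (?r (\<kappa> a))\<^sup>2 else 1)"
    have "(\<Sum>a<m. y a) = real m + (\<Sum>a\<in>T. (?r (\<kappa> a))\<^sup>2)"
    proof -
      have "(\<Sum>a<m. y a) = (\<Sum>a<m. 1 + (if a \<in> T then (?r (\<kappa> a))\<^sup>2 else 0))"
        by (intro sum.cong) (auto simp: y_def)
      also have "\<dots> = real m + (\<Sum>a\<in>{..<m} \<inter> T. (?r (\<kappa> a))\<^sup>2)"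
        by (simp add: sum.distrib sum.inter_restrict)
      also have "{..<m} \<inter> T = T" using T by auto
      finally show ?thesis .
    qed
    also have "(\<Sum>a\<in>T. (?r (\<kappa> a))\<^sup>2) = (\<Sum>i\<in>\<kappa> ` T. (?r i)\<^sup>2)"
      by (simp add: sum.reindex[OF inj])
    also have "real m + \<dots> \<le> real m + (\<Sum>i\<in>K. (?r i)\<^sup>2)"
      using \<kappa>(1) by (intro add_left_mono sum_mono2 K) auto
    also have "\<dots> \<le> real m * L" by (rule L)
    finally have ysum: "(\<Sum>a<m. y a) \<le> real m * L" .
    have "norm (minor_det m f) \<le> B * (\<Prod>a\<in>T. ?r (\<kappa> a))"
    proof (rule norm_minor_det_row_combinations[OF T vol])
      show "f a \<in> X" if "a < m" "a \<notin> T" for a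
        using that by (simp add: T_def)
      show "u (\<kappa> a) \<in> X" "v (\<kappa> a) \<in> X" if "a \<in> T" for a
        using uv \<kappa>(1)[OF that] by simp_all
      show "f a = ?g (\<kappa> a)" if "a \<in> T" for a
        using \<kappa>(2)[OF that] .
    qed
    also have "(\<Prod>a\<in>T. ?r (\<kappa> a)) \<le> (\<Prod>a\<in>T. sqrt (y a))"
      by (intro prod_mono) (auto simp: y_def intro!: real_le_rsqrt)
    also have "(\<Prod>a\<in>T. sqrt (y a)) = (\<Prod>a<m. sqrt (y a))"
      by (rule prod.mono_neutral_left) (use T in \<open>auto simp: y_def\<close>)
    also have "\<dots> = sqrt (\<Prod>a<m. y a)"
      by (induction m) (auto simp: real_sqrt_mult)
    also have "\<dots> \<le> sqrt (L ^ m)"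
      using prod_le_mean_power[of "{..<m}" y L] ysum L0 by (auto simp: y_def)
    finally show ?thesis
      using B by (simp add: real_sqrt_power mult_left_mono)
  qed
qed

section \<open>Random sign vectors\<close>

text \<open>A sign vector is coded by the set of its positive positions; a sum over
  \<open>Pow {..<N}\<close> is \<open>2 ^ N\<close> times an expectation over independent uniform
  signs.\<close>

definition sign_vec :: "nat set \<Rightarrow> nat \<Rightarrow> complex" where
  "sign_vec A i = (if i \<in> A then 1 else -1)"

lemma sum_Pow_lessThan_Suc:
  "(\<Sum>A\<in>Pow {..<Suc N}. F A) = (\<Sum>A\<in>Pow {..<N}. F A + (F (insert N A) :: 'a :: comm_monoid_add))"
proof -
  have "inj_on (insert N) (Pow {..<N})"
    by (rule inj_onI) (metis Diff_insert_absorb PowD lessThan_iff less_irrefl subsetD)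
  moreover have "Pow {..<N} \<inter> insert N ` Pow {..<N} = {}" by auto
  ultimately show ?thesis
    by (simp add: lessThan_Suc Pow_insert sum.union_disjoint sum.reindex sum.distrib)
qed

lemma sign_sum_Suc:
  assumes "A \<in> Pow {..<N}"
  shows "(\<Sum>i<Suc N. sign_vec A i * c i) = (\<Sum>i<N. sign_vec A i * c i) - c N"
    and "(\<Sum>i<Suc N. sign_vec (insert N A) i * c i) = (\<Sum>i<N. sign_vec A i * c i) + c N"
  using assms by (auto simp: sign_vec_def intro!: sum.cong)

text \<open>Independent signs are uncorrelated; in the induction the mixed terms cancel by the
  parallelogram law.\<close>

lemma sign_second_moment:
  "(\<Sum>A\<in>Pow {..<N}. (norm (\<Sum>i<N. sign_vec A i * c i))\<^sup>2) = 2 ^ N * (\<Sum>i<N. (norm (c i))\<^sup>2)"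
proof (induction N)
  case (Suc N)
  have par: "(norm (x - y))\<^sup>2 + (norm (x + y))\<^sup>2 = 2 * (norm x)\<^sup>2 + 2 * (norm y)\<^sup>2" for x y :: complex
    unfolding cmod_power2 by (simp add: power2_eq_square algebra_simps)
  have "(\<Sum>A\<in>Pow {..<Suc N}. (norm (\<Sum>i<Suc N. sign_vec A i * c i))\<^sup>2)
      = (\<Sum>A\<in>Pow {..<N}. 2 * (norm (\<Sum>i<N. sign_vec A i * c i))\<^sup>2 + 2 * (norm (c N))\<^sup>2)"
    unfolding sum_Pow_lessThan_Suc by (intro sum.cong refl) (simp only: sign_sum_Suc par)
  also have "\<dots> = 2 ^ Suc N * (\<Sum>i<Suc N. (norm (c i))\<^sup>2)"
    unfolding sum.distrib sum_distrib_left[symmetric] Suc.IH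
    by (simp add: card_Pow algebra_simps)
  finally show ?case .
qed simp

text \<open>A Khinchine inequality with constant 3. Averaging over the last sign cancels the odd
  terms, and the mixed even terms are bounded by Cauchy--Schwarz.\<close>

lemma sign_fourth_moment:
  "(\<Sum>A\<in>Pow {..<N}. (norm (\<Sum>i<N. sign_vec A i * c i)) ^ 4) \<le> 2 ^ N * (3 * (\<Sum>i<N. (norm (c i))\<^sup>2)\<^sup>2)"
proof (induction N)
  case (Suc N)
  let ?X = "\<lambda>A. \<Sum>i<N. sign_vec A i * c i" and ?s = "\<Sum>i<N. (norm (c i))\<^sup>2"
  have par: "(norm (x - y)) ^ 4 + (norm (x + y)) ^ 4
      \<le> 2 * (norm x) ^ 4 + 12 * ((norm y)\<^sup>2 * (norm x)\<^sup>2) + 2 * (norm y) ^ 4" for x y :: complex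
  proof -
    \<comment> \<open>The real inner product of \<open>x\<close> and \<open>y\<close>; it is the
      only part of the squared norms that changes with the sign.\<close>
    define t where "t = Re x * Re y + Im x * Im y"
    have n: "(norm (x - y))\<^sup>2 = (norm x)\<^sup>2 + (norm y)\<^sup>2 - 2 * t"
      "(norm (x + y))\<^sup>2 = (norm x)\<^sup>2 + (norm y)\<^sup>2 + 2 * t"
      unfolding cmod_power2 t_def by (simp_all add: power2_eq_square algebra_simps)
    have "t\<^sup>2 \<le> (norm x)\<^sup>2 * (norm y)\<^sup>2"
    proof -
      have "(norm x)\<^sup>2 * (norm y)\<^sup>2 - t\<^sup>2 = (Re x * Im y - Im x * Re y)\<^sup>2"
        unfolding cmod_power2 t_def by (simp add: power2_eq_square algebra_simps)
      thus ?thesis by (metis diff_ge_0_iff_ge zero_le_power2)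
    qed
    moreover have "2 * (a + b)\<^sup>2 + 8 * T \<le> 2 * a\<^sup>2 + 12 * (b * a) + 2 * b\<^sup>2" if "T \<le> a * b" for a b T :: real
      using that by (simp add: power2_sum algebra_simps)
    moreover have "((norm (x - y))\<^sup>2)\<^sup>2 + ((norm (x + y))\<^sup>2)\<^sup>2 = 2 * ((norm x)\<^sup>2 + (norm y)\<^sup>2)\<^sup>2 + 8 * t\<^sup>2"
      unfolding n by (simp add: power2_eq_square algebra_simps)
    ultimately have "((norm (x - y))\<^sup>2)\<^sup>2 + ((norm (x + y))\<^sup>2)\<^sup>2
        \<le> 2 * ((norm x)\<^sup>2)\<^sup>2 + 12 * ((norm y)\<^sup>2 * (norm x)\<^sup>2) + 2 * ((norm y)\<^sup>2)\<^sup>2"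
      by presburger
    thus ?thesis by (simp flip: power_mult)
  qed
  have "(\<Sum>A\<in>Pow {..<Suc N}. (norm (\<Sum>i<Suc N. sign_vec A i * c i)) ^ 4)
      \<le> (\<Sum>A\<in>Pow {..<N}. 2 * (norm (?X A)) ^ 4 + 12 * ((norm (c N))\<^sup>2 * (norm (?X A))\<^sup>2) + 2 * (norm (c N)) ^ 4)"
    unfolding sum_Pow_lessThan_Suc by (intro sum_mono) (simp only: sign_sum_Suc par)
  also have "\<dots> = 2 * (\<Sum>A\<in>Pow {..<N}. (norm (?X A)) ^ 4) + 12 * ((norm (c N))\<^sup>2 * (2 ^ N * ?s))
      + 2 ^ N * (2 * (norm (c N)) ^ 4)"
    by (simp add: sum.distrib card_Pow sign_second_moment flip: sum_distrib_left)
  also have "\<dots> \<le> 2 * (2 ^ N * (3 * ?s\<^sup>2)) + 12 * ((norm (c N))\<^sup>2 * (2 ^ N * ?s))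
      + 2 ^ N * (2 * (norm (c N)) ^ 4)"
    using Suc.IH by simp
  also have "\<dots> = 2 ^ Suc N * (3 * (?s + (norm (c N))\<^sup>2)\<^sup>2 - 2 * (norm (c N)) ^ 4)"
    by (simp add: power2_sum algebra_simps flip: power_mult)
  also have "\<dots> \<le> 2 ^ Suc N * (3 * (?s + (norm (c N))\<^sup>2)\<^sup>2)"
    by (intro mult_left_mono) auto
  finally show ?case by simp
qed simp

section \<open>Linear and quadratic parts of circuits\<close>

text \<open>Restricting to lines through the origin replaces polynomials in \<open>n\<close>
  variables by univariate ones whose degree 1 and 2 coefficients, as functions of the direction, are
  the linear and quadratic parts.\<close>

fun instr_poly :: "complex poly list \<Rightarrow> instr \<Rightarrow> complex poly" where
  "instr_poly ps (Add u v) = ps ! u + ps ! v"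
| "instr_poly ps (Sub u v) = ps ! u - ps ! v"
| "instr_poly ps (Mul u v) = ps ! u * ps ! v"
| "instr_poly ps (Scale c u) = smult c (ps ! u)"

text \<open>The values of a circuit on the line through the origin spanned by the point \<open>x\<close>.\<close>

definition circuit_polys :: "nat \<Rightarrow> instr list \<Rightarrow> (nat \<Rightarrow> complex) \<Rightarrow> complex poly list" where
  "circuit_polys n P x =
     foldl (\<lambda>ps ins. ps @ [instr_poly ps ins]) (map (\<lambda>i. [:0, x i:]) [1..<Suc n]) P"

definition lin :: "nat \<Rightarrow> instr list \<Rightarrow> nat \<Rightarrow> (nat \<Rightarrow> complex) \<Rightarrow> complex" where
  "lin n P j x = coeff (circuit_polys n P x ! j) 1"

definition quad :: "nat \<Rightarrow> instr list \<Rightarrow> nat \<Rightarrow> (nat \<Rightarrow> complex) \<Rightarrow> complex" where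
  "quad n P j x = coeff (circuit_polys n P x ! j) 2"

text \<open>The polarisation of the quadratic part, with the convention that
  \<open>bil n P j x x\<close> is twice \<open>quad n P j x\<close>.\<close>

definition bil :: "nat \<Rightarrow> instr list \<Rightarrow> nat \<Rightarrow> (nat \<Rightarrow> complex) \<Rightarrow> (nat \<Rightarrow> complex) \<Rightarrow> complex" where
  "bil n P j x y = quad n P j (\<lambda>i. x i + y i) - quad n P j x - quad n P j y"

lemma circuit_Nil [simp]: "circuit n []"
  by (simp add: circuit_def)

lemma circuit_snoc:
  "circuit n (P @ [ins]) \<longleftrightarrow> circuit n P \<and> (\<forall>u\<in>operands ins. u < n + length P)"
  by (auto simp: circuit_def nth_append less_Suc_eq)

lemma circuit_values_snoc:
  "circuit_values n (P @ [ins]) = circuit_values n P @ [instr_value (circuit_values n P) ins]"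
  by (simp add: circuit_values_def)

lemma circuit_polys_snoc:
  "circuit_polys n (P @ [ins]) x = circuit_polys n P x @ [instr_poly (circuit_polys n P x) ins]"
  by (simp add: circuit_polys_def)

lemma circuit_values_Nil: "circuit_values n [] = map (\<lambda>i a. a i) [1..<Suc n]"
  by (simp add: circuit_values_def input_values_def)

lemma circuit_polys_Nil: "circuit_polys n [] x = map (\<lambda>i. [:0, x i:]) [1..<Suc n]"
  by (simp add: circuit_polys_def)

lemma length_circuit_values [simp]: "length (circuit_values n P) = n + length P"
  by (induction P rule: rev_induct) (auto simp: circuit_values_snoc circuit_values_Nil)

lemma length_circuit_polys [simp]: "length (circuit_polys n P x) = n + length P"
  by (induction P rule: rev_induct) (auto simp: circuit_polys_snoc circuit_polys_Nil)

lemma bounded_coefficient_snoc: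
  "bounded_coefficient (P @ [ins])
    \<longleftrightarrow> bounded_coefficient P \<and> (\<forall>c u. ins = Scale c u \<longrightarrow> norm c \<le> 2)"
  by (auto simp: bounded_coefficient_def)

lemma poly_circuit_polys:
  assumes "circuit n P" "j < n + length P"
  shows "poly (circuit_polys n P x ! j) t = (circuit_values n P ! j) (\<lambda>i. t * x i)"
  using assms
proof (induction P arbitrary: j rule: rev_induct)
  case Nil
  thus ?case by (simp add: circuit_values_Nil circuit_polys_Nil del: upt_Suc)
next
  case (snoc ins P)
  show ?case
  proof (cases "j < n + length P")
    case True
    thus ?thesis using snoc
      by (simp add: circuit_values_snoc circuit_polys_snoc nth_append circuit_snoc)
  next
    case False
    hence "j = n + length P" using snoc.prems by simp
    thus ?thesis using snoc
      by (cases ins) (simp_all add: circuit_values_snoc circuit_polys_snoc nth_append circuit_snoc)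
  qed
qed

text \<open>The inputs vanish at the origin and no instruction introduces a constant. Hence a
  product has no linear part, and its quadratic part is the product of the two linear parts.\<close>

lemma coeff_0_circuit_polys:
  assumes "circuit n P" "j < n + length P"
  shows "coeff (circuit_polys n P x ! j) 0 = 0"
  using assms
proof (induction P arbitrary: j rule: rev_induct)
  case Nil
  thus ?case by (simp add: circuit_polys_Nil del: upt_Suc)
next
  case (snoc ins P)
  show ?case
  proof (cases "j < n + length P")
    case True
    thus ?thesis using snoc
      by (simp add: circuit_polys_snoc nth_append circuit_snoc)
  next
    case False
    hence "j = n + length P" using snoc.prems by simp
    thus ?thesis using snoc
      by (cases ins) (simp_all add: circuit_polys_snoc nth_append circuit_snoc coeff_mult)
  qed
qed

lemma lin_prefix: "j < n + length P \<Longrightarrow> lin n (P @ [ins]) j x = lin n P j x"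
  by (simp add: lin_def circuit_polys_snoc nth_append)

lemma quad_prefix: "j < n + length P \<Longrightarrow> quad n (P @ [ins]) j x = quad n P j x"
  by (simp add: quad_def circuit_polys_snoc nth_append)

lemma bil_prefix: "j < n + length P \<Longrightarrow> bil n (P @ [ins]) j x y = bil n P j x y"
  by (simp add: bil_def quad_prefix)

lemma lin_input: "j < n \<Longrightarrow> lin n P j x = x (Suc j)"
  by (induction P rule: rev_induct) (auto simp: lin_prefix, auto simp: lin_def circuit_polys_Nil simp del: upt_Suc)

lemma quad_input: "j < n \<Longrightarrow> quad n P j x = 0"
  by (induction P rule: rev_induct)
     (auto simp: quad_prefix, auto simp: quad_def circuit_polys_Nil numeral_2_eq_2 simp del: upt_Suc)

lemma lin_last:
  assumes "circuit n (P @ [ins])"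
  shows "lin n (P @ [ins]) (n + length P) x = (case ins of
      Add u v \<Rightarrow> lin n P u x + lin n P v x
    | Sub u v \<Rightarrow> lin n P u x - lin n P v x
    | Mul u v \<Rightarrow> 0
    | Scale c u \<Rightarrow> c * lin n P u x)"
  using assms
  by (cases ins) (simp_all add: lin_def circuit_polys_snoc nth_append circuit_snoc coeff_mult
      coeff_0_circuit_polys)

lemma quad_last:
  assumes "circuit n (P @ [ins])"
  shows "quad n (P @ [ins]) (n + length P) x = (case ins of
      Add u v \<Rightarrow> quad n P u x + quad n P v x
    | Sub u v \<Rightarrow> quad n P u x - quad n P v x
    | Mul u v \<Rightarrow> lin n P u x * lin n P v x
    | Scale c u \<Rightarrow> c * quad n P u x)"
  using assms
  by (cases ins) (simp_all add: lin_def quad_def circuit_polys_snoc nth_append circuit_snoc coeff_mult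
      coeff_0_circuit_polys numeral_2_eq_2)

lemma lin_sum:
  assumes "circuit n P" "j < n + length P"
  shows "lin n P j (\<lambda>i. \<Sum>l\<in>A. c l * X l i) = (\<Sum>l\<in>A. c l * lin n P j (X l))"
  using assms
proof (induction P arbitrary: j rule: rev_induct)
  case Nil
  thus ?case by (simp add: lin_input)
next
  case (snoc ins P)
  show ?case
  proof (cases "j < n + length P")
    case True
    thus ?thesis using snoc by (simp add: lin_prefix circuit_snoc)
  next
    case False
    hence j: "j = n + length P" using snoc.prems by simp
    show ?thesis using snoc unfolding j
      by (cases ins) (simp_all add: lin_last circuit_snoc sum.distrib sum_subtractf
          sum_distrib_left algebra_simps)
  qed
qed

lemma lin_add:
  assumes "circuit n P" "j < n + length P"
  shows "lin n P j (\<lambda>i. x i + y i) = lin n P j x + lin n P j y"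
  \<comment> \<open>A sum over the two Booleans expresses the two-term sum.\<close>
  using lin_sum[OF assms, of "\<lambda>_. 1" "\<lambda>b. if b then x else y" UNIV] by (simp add: UNIV_bool add.commute)

lemma bil_last:
  assumes "circuit n (P @ [ins])"
  shows "bil n (P @ [ins]) (n + length P) x y = (case ins of
      Add u v \<Rightarrow> bil n P u x y + bil n P v x y
    | Sub u v \<Rightarrow> bil n P u x y - bil n P v x y
    | Mul u v \<Rightarrow> lin n P u x * lin n P v y + lin n P v x * lin n P u y
    | Scale c u \<Rightarrow> c * bil n P u x y)"
  using assms
  by (cases ins) (simp_all add: bil_def quad_last circuit_snoc lin_add algebra_simps)

section \<open>Growth of minors along a circuit\<close>

text \<open>Morgenstern's argument: each instruction adds a row that is a combination of earlier
  rows with coefficients of total modulus at most 2, a multiplication adding the zero row. Column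
  \<open>b\<close> evaluates the linear parts at the point \<open>E b\<close>.\<close>

lemma volbound_lin:
  assumes "circuit n P" "bounded_coefficient P" "volbound m X B" "(\<lambda>_. 0) \<in> X"
    and "\<And>j. j < n \<Longrightarrow> (\<lambda>b. E b (Suc j)) \<in> X"
  shows "volbound m (X \<union> (\<lambda>j b. lin n P j (E b)) ` {..<n + length P}) (2 ^ length P * B)"
  using assms(1,2)
proof (induction P rule: rev_induct)
  case Nil
  have "(\<lambda>j b. lin n [] j (E b)) ` {..<n} \<subseteq> X"
    using assms(5) by (auto simp: lin_input)
  thus ?case using assms(3) by (simp add: Un_absorb2)
next
  case (snoc ins P)
  let ?R = "\<lambda>P j b. lin n P j (E b)"
  let ?Y = "X \<union> ?R P ` {..<n + length P}"
  have vol: "volbound m ?Y (2 ^ length P * B)"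
    using snoc by (simp add: circuit_snoc bounded_coefficient_snoc)
  have rows: "?R (P @ [ins]) ` {..<n + length (P @ [ins])}
      = insert (?R (P @ [ins]) (n + length P)) (?R P ` {..<n + length P})"
    by (simp add: lessThan_Suc lin_prefix cong: image_cong_simp)
  have comb: "volbound m (insert (\<lambda>b. c * u b + d * v b) ?Y) (2 ^ length (P @ [ins]) * B)"
    if "u \<in> ?Y" "v \<in> ?Y" "norm c + norm d \<le> 2" for u v c d
    using volbound_insert_combination[OF vol that] by (simp add: mult.assoc)
  have mem: "?R P j \<in> ?Y" if "j < n + length P" for j using that by blast
  have "volbound m (insert (?R (P @ [ins]) (n + length P)) ?Y) (2 ^ length (P @ [ins]) * B)"
  proof (cases ins)
    case (Add u v)
    with snoc.prems(1) show ?thesis using comb[OF mem mem, of u v 1 1]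
      by (simp add: lin_last circuit_snoc)
  next
    case (Sub u v)
    with snoc.prems(1) show ?thesis using comb[OF mem mem, of u v 1 "-1"]
      by (simp add: lin_last circuit_snoc)
  next
    case (Mul u v)
    with snoc.prems(1) show ?thesis using comb[OF mem mem, of u v 0 0]
      by (simp add: lin_last circuit_snoc)
  next
    case (Scale c u)
    with snoc.prems show ?thesis using comb[OF mem mem, of u u c 0]
      by (simp add: lin_last circuit_snoc bounded_coefficient_snoc)
  qed
  thus ?case unfolding rows by simp
qed

text \<open>The value 0 for other instructions lets all instruction numbers be treated as
  multiplications.\<close>

definition mul_left :: "nat \<Rightarrow> instr list \<Rightarrow> nat \<Rightarrow> (nat \<Rightarrow> complex) \<Rightarrow> complex" where
  "mul_left n P i x = (case P ! i of Mul u v \<Rightarrow> lin n P u x | _ \<Rightarrow> 0)"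

definition mul_right :: "nat \<Rightarrow> instr list \<Rightarrow> nat \<Rightarrow> (nat \<Rightarrow> complex) \<Rightarrow> complex" where
  "mul_right n P i x = (case P ! i of Mul u v \<Rightarrow> lin n P v x | _ \<Rightarrow> 0)"

definition mul_row :: "nat \<Rightarrow> instr list \<Rightarrow> (nat \<Rightarrow> complex) \<Rightarrow> (nat \<Rightarrow> nat \<Rightarrow> complex) \<Rightarrow> nat \<Rightarrow> nat \<Rightarrow> complex" where
  "mul_row n P x E i b = mul_left n P i x * mul_right n P i (E b) + mul_right n P i x * mul_left n P i (E b)"

lemma operand_less: "circuit n P \<Longrightarrow> i < length P \<Longrightarrow> u \<in> operands (P ! i) \<Longrightarrow> u < n + length P"
  unfolding circuit_def by fastforce

lemma mul_row_prefix:
  assumes "circuit n P" "i < length P"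
  shows "mul_row n (P @ [ins]) x E i = mul_row n P x E i"
  using operand_less[OF assms]
  by (cases "P ! i") (auto simp: mul_row_def mul_left_def mul_right_def nth_append lin_prefix assms(2))

text \<open>For fixed \<open>x\<close> the bilinear parts obey the recursion of the linear ones,
  except at multiplications. Their rows are supplied in \<open>X\<close> beforehand, so that their
  cost can be estimated jointly in \<open>B\<close>.\<close>

lemma volbound_bil:
  assumes "circuit n P" "bounded_coefficient P" "volbound m X B" "(\<lambda>_. 0) \<in> X"
    and "\<And>i. i < length P \<Longrightarrow> mul_row n P x E i \<in> X"
  shows "volbound m (X \<union> (\<lambda>j b. bil n P j x (E b)) ` {..<n + length P}) (2 ^ length P * B)"
  using assms(1,2,5)
proof (induction P rule: rev_induct)
  case Nil
  have "(\<lambda>j b. bil n [] j x (E b)) ` {..<n} \<subseteq> X"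
    using assms(4) by (auto simp: bil_def quad_input)
  thus ?case using assms(3) by (simp add: Un_absorb2)
next
  case (snoc ins P)
  let ?R = "\<lambda>P j b. bil n P j x (E b)"
  let ?Y = "X \<union> ?R P ` {..<n + length P}"
  have circ: "circuit n P" using snoc.prems by (simp add: circuit_snoc)
  have "mul_row n P x E i \<in> X" if "i < length P" for i
    using snoc.prems(3)[of i] that by (simp add: mul_row_prefix[OF circ])
  hence vol: "volbound m ?Y (2 ^ length P * B)"
    using snoc by (simp add: circuit_snoc bounded_coefficient_snoc)
  have rows: "?R (P @ [ins]) ` {..<n + length (P @ [ins])}
      = insert (?R (P @ [ins]) (n + length P)) (?R P ` {..<n + length P})"
    by (simp add: lessThan_Suc bil_prefix cong: image_cong_simp)
  have comb: "volbound m (insert (\<lambda>b. c * u b + d * v b) ?Y) (2 ^ length (P @ [ins]) * B)"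
    if "u \<in> ?Y" "v \<in> ?Y" "norm c + norm d \<le> 2" for u v c d
    using volbound_insert_combination[OF vol that] by (simp add: mult.assoc)
  have mem: "?R P j \<in> ?Y" if "j < n + length P" for j using that by blast
  have "volbound m (insert (?R (P @ [ins]) (n + length P)) ?Y) (2 ^ length (P @ [ins]) * B)"
  proof (cases ins)
    case (Add u v)
    with snoc.prems(1) show ?thesis using comb[OF mem mem, of u v 1 1]
      by (simp add: bil_last circuit_snoc)
  next
    case (Sub u v)
    with snoc.prems(1) show ?thesis using comb[OF mem mem, of u v 1 "-1"]
      by (simp add: bil_last circuit_snoc)
  next
    case (Mul u v)
    have "?R (P @ [ins]) (n + length P) = mul_row n (P @ [ins]) x E (length P)"
      using snoc.prems(1) Mul
      by (simp add: bil_last mul_row_def mul_left_def mul_right_def fun_eq_iff lin_prefix circuit_snoc)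
    also have "\<dots> \<in> ?Y" using snoc.prems(3)[of "length P"] by simp
    finally show ?thesis
      using comb[of "?R (P @ [ins]) (n + length P)" "?R (P @ [ins]) (n + length P)" 1 0] by simp
  next
    case (Scale c u)
    with snoc.prems show ?thesis using comb[OF mem mem, of u u c 0]
      by (simp add: bil_last circuit_snoc bounded_coefficient_snoc)
  qed
  thus ?case unfolding rows by simp
qed

section \<open>The quadratic part of the inverse coefficients\<close>

fun inv_poly :: "(nat \<Rightarrow> complex) \<Rightarrow> nat \<Rightarrow> complex poly" where
  "inv_poly x k = (if k = 0 then 1 else \<Sum>i<k. [:0, x (k - i):] * inv_poly x i)"

declare inv_poly.simps [simp del]

lemma poly_inv_poly:
  "k \<le> n \<Longrightarrow> poly (inv_poly x k) t = inverse_coeff n k (\<lambda>i. t * x i)"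
proof (induction k rule: less_induct)
  case (less k)
  show ?case
  proof (cases "k = 0")
    case True
    thus ?thesis by (simp add: inv_poly.simps inverse_coeff_0)
  next
    case False
    with less show ?thesis
      by (subst inv_poly.simps) (simp add: inverse_coeff_rec poly_sum mult_ac)
  qed
qed

lemma coeff_0_inv_poly: "coeff (inv_poly x k) 0 = (if k = 0 then 1 else 0)"
  by (subst inv_poly.simps) (simp add: coeff_sum coeff_mult)

lemma coeff_1_inv_poly: "coeff (inv_poly x k) 1 = (if k = 0 then 0 else x k)"
proof (cases "k = 0")
  case False
  have "coeff (inv_poly x k) 1 = (\<Sum>i<k. x (k - i) * (if i = 0 then 1 else 0))"
    using False by (subst inv_poly.simps) (simp add: coeff_sum coeff_mult coeff_0_inv_poly)
  also have "\<dots> = (\<Sum>i<k. if i = 0 then x k else 0)"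
    by (rule sum.cong) auto
  finally have "coeff (inv_poly x k) 1 = (\<Sum>i<k. if i = 0 then x k else 0)" .
  thus ?thesis using False by simp
qed (simp add: inv_poly.simps)

lemma coeff_2_inv_poly: "coeff (inv_poly x k) 2 = (\<Sum>i\<in>{1..<k}. x (k - i) * x i)"
proof (cases "k = 0")
  case False
  have "coeff (inv_poly x k) 2 = (\<Sum>i<k. if i = 0 then 0 else x (k - i) * x i)"
    using False coeff_1_inv_poly[of x]
    by (subst inv_poly.simps)
       (auto simp: coeff_sum coeff_mult numeral_2_eq_2 intro!: sum.cong)
  also have "\<dots> = (\<Sum>i\<in>{1..<k}. x (k - i) * x i)"
    by (rule sum.mono_neutral_cong_right) auto
  finally show ?thesis .
qed (simp add: inv_poly.simps)

text \<open>Along each line the computed polynomial and \<open>inv_poly x k\<close> agree as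
  functions, hence in their coefficients. Reversing \<open>i\<close> to \<open>k - i\<close> shows
  that both halves of the polarised convolution are equal.\<close>

lemma output_bil:
  assumes "circuit n P" "computes n P (inverse_coeff n ` {1..n})" "k \<in> {1..n}"
  obtains j where "j < n + length P"
    "\<And>x y. bil n P j x y = 2 * (\<Sum>i\<in>{1..<k}. x (k - i) * y i)"
proof -
  obtain j where j: "j < n + length P" "circuit_values n P ! j = inverse_coeff n k"
  proof -
    have "inverse_coeff n k \<in> set (circuit_values n P)"
      using assms(2,3) by (auto simp: computes_def)
    thus ?thesis using that by (auto simp: in_set_conv_nth)
  qed
  have quad: "quad n P j x = (\<Sum>i\<in>{1..<k}. x (k - i) * x i)" for x
  proof -
    have "poly (circuit_polys n P x ! j) = poly (inv_poly x k)"
      using assms(3) by (intro ext) (simp add: poly_circuit_polys[OF assms(1) j(1)] j(2) poly_inv_poly[of k n])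
    thus ?thesis by (simp add: quad_def poly_eq_poly_eq_iff coeff_2_inv_poly)
  qed
  have "bil n P j x y = 2 * (\<Sum>i\<in>{1..<k}. x (k - i) * y i)" for x y
  proof -
    have "(\<Sum>i\<in>{1..<k}. y (k - i) * x i) = (\<Sum>i\<in>{1..<k}. x (k - i) * y i)"
      by (rule sum.reindex_bij_witness[of _ "\<lambda>i. k - i" "\<lambda>i. k - i"]) auto
    thus ?thesis
      by (simp add: bil_def quad algebra_simps sum.distrib)
  qed
  with j(1) show ?thesis by (rule that)
qed

section \<open>The discrete Fourier transform\<close>

text \<open>The \<open>i\<close>-th character of the cyclic group of order \<open>N\<close>,
  evaluated at \<open>r\<close>.\<close>

definition fourier :: "nat \<Rightarrow> nat \<Rightarrow> nat \<Rightarrow> complex" where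
  "fourier N i r = cis (2 * pi * real i / real N) ^ r"

lemma fourier_commute: "fourier N i r = fourier N r i"
  by (simp add: fourier_def DeMoivre mult_ac)

lemma norm_fourier [simp]: "norm (fourier N i r) = 1"
  by (simp add: fourier_def norm_power)

lemma fourier_mult_cnj: "fourier N i r * cnj (fourier N i r) = 1"
  by (simp flip: complex_norm_square)

lemma fourier_add: "fourier N i (r + s) = fourier N i r * fourier N i s"
  by (simp add: fourier_def power_add)

lemma fourier_period: "N > 0 \<Longrightarrow> cis (2 * pi * real i / real N) ^ N = 1"
  by (simp add: DeMoivre cis_multiple_2pi)

lemma fourier_mod: "N > 0 \<Longrightarrow> fourier N i (r mod N) = fourier N i r"
proof -
  assume N: "N > 0"
  have "fourier N i r = fourier N i (N * (r div N) + r mod N)" by simp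
  also have "\<dots> = fourier N i (r mod N)"
    unfolding fourier_add using fourier_period[OF N, of i] by (simp add: fourier_def power_mult)
  finally show ?thesis by simp
qed

text \<open>For different characters the inner product is a geometric sum with ratio
  \<open>q \<noteq> 1\<close> and \<open>q ^ N = 1\<close>.\<close>

lemma fourier_orthogonal:
  assumes "i < N" "j < N"
  shows "ip N (fourier N i) (fourier N j) = (if i = j then of_nat N else 0)"
proof (cases "i = j")
  case True
  thus ?thesis by (simp add: ip_def fourier_mult_cnj)
next
  case False
  let ?w = "\<lambda>i. cis (2 * pi * real i / real N)"
  define q where "q = ?w i * cnj (?w j)"
  have N: "N > 0" using assms by simp
  have "inj_on ?w {..<N}"
    using bij_betw_roots_unity[OF N] by (simp add: bij_betw_def)
  hence "?w i \<noteq> ?w j" using False assms by (auto simp: inj_on_def)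
  moreover have "q * ?w j = ?w i" by (simp add: q_def cis_cnj cis_mult)
  ultimately have "q \<noteq> 1" by auto
  moreover have "q ^ N = 1"
    using fourier_period[OF N] by (simp add: q_def power_mult_distrib flip: complex_cnj_power)
  moreover have "ip N (fourier N i) (fourier N j) = (\<Sum>r<N. q ^ r)"
    by (simp add: ip_def fourier_def q_def power_mult_distrib)
  ultimately show ?thesis using False by (simp add: sum_gp_strict)
qed

lemma parseval:
  assumes "N > 0"
  shows "(\<Sum>i<N. (norm (ip N z (fourier N i)))\<^sup>2) = real N * sqnorm N z"
proof -
  have "complex_of_real (\<Sum>i<N. (norm (ip N z (fourier N i)))\<^sup>2)
      = (\<Sum>i<N. ip N z (fourier N i) * cnj (ip N z (fourier N i)))"
    by (simp add: complex_norm_square del: of_real_power)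
  also have "\<dots> = (\<Sum>i<N. \<Sum>r<N. \<Sum>s<N. z r * cnj (z s) * (fourier N s i * cnj (fourier N r i)))"
    unfolding ip_def cnj_sum sum_product
    by (intro sum.cong refl) (simp add: fourier_commute mult_ac)
  also have "\<dots> = (\<Sum>r<N. \<Sum>s<N. \<Sum>i<N. z r * cnj (z s) * (fourier N s i * cnj (fourier N r i)))"
    by (rule trans[OF sum.swap sum.cong[OF refl sum.swap]])
  also have "\<dots> = (\<Sum>r<N. \<Sum>s<N. z r * cnj (z s) * ip N (fourier N s) (fourier N r))"
    by (simp add: ip_def flip: sum_distrib_left)
  also have "\<dots> = (\<Sum>r<N. \<Sum>s<N. if s = r then z r * cnj (z s) * of_nat N else 0)"
    by (intro sum.cong refl) (simp add: fourier_orthogonal)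
  also have "\<dots> = (\<Sum>r<N. of_nat N * (z r * cnj (z r)))"
    by (intro sum.cong refl) simp
  also have "\<dots> = of_nat N * ip N z z"
    by (simp add: ip_def sum_distrib_left)
  also have "\<dots> = complex_of_real (real N * sqnorm N z)" by (simp add: ip_self)
  finally show ?thesis by (simp only: of_real_eq_iff)
qed

lemma sqnorm_cnj: "(\<Sum>i<N. (norm (cnj (u i)))\<^sup>2) = sqnorm N u"
  by (simp add: sqnorm_def)

lemma sqnorm_sign_vec: "sqnorm N (sign_vec A) = real N"
  by (simp add: sqnorm_def sign_vec_def if_distrib cong: if_cong)

lemma sqnorm_fourier: "sqnorm N (fourier N i) = real N"
  by (simp add: sqnorm_def)

text \<open>The point is the projection of a random sign vector to the orthogonal complement of the
  \<open>e\<^sub>b\<close>.  Fourth moments keep its Fourier coefficients from concentrating on few frequencies.\<close>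

lemma well_spread_point:
  assumes N: "N > 0" and e: "orthonormal N k e" and k: "8 * k \<le> N"
    and G: "finite G" "G \<noteq> {}" and \<rho>: "\<rho> > 0"
    and v: "\<And>g. g \<in> G \<Longrightarrow> sqnorm N (proj_off N k e (v g)) \<le> \<rho>\<^sup>2"
  obtains z where "(\<Sum>g\<in>G. (norm (ip N z (v g)))\<^sup>2) \<le> 8 * \<rho>\<^sup>2 * real (card G)"
    "N \<le> 8 * card {i. i < N \<and> real N \<le> 8 * (norm (ip N z (fourier N i)))\<^sup>2}"
proof -
  define z where "z A = proj_off N k e (sign_vec A)" for A
  define Q where "Q A = (\<Sum>g\<in>G. (norm (ip N (z A) (v g)))\<^sup>2)" for A
  define x where "x A i = (norm (ip N (z A) (fourier N i)))\<^sup>2 / real N" for A i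
  define \<beta> where "\<beta> = real N / (8 * \<rho>\<^sup>2 * real (card G))"
  \<comment> \<open>By Parseval \<open>sqnorm N (z A)\<close> is the sum of the
    \<open>x A i\<close>. The penalties disfavour concentrated spectra and large \<open>Q A\<close>;
    \<beta> makes the second one at most \<open>N / 8\<close> on average, so \<open>F\<close> has
    mean at least \<open>7N/8 - 3N/8 - N/8 = 3N/8\<close>.\<close>
  define F where "F A = sqnorm N (z A) - (\<Sum>i<N. (x A i)\<^sup>2) / 8 - \<beta> * Q A" for A
  let ?\<Omega> = "Pow {..<N}"
  have cG: "real (card G) > 0" using G by (simp add: card_gt_0_iff)
  have \<beta>: "\<beta> > 0" using N \<rho> cG by (simp add: \<beta>_def)
  \<comment> \<open>Self-adjointness moves the projection onto \<open>u\<close>, leaving a plain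
    sign sum to which the moment lemmas apply.\<close>
  have ipz: "ip N (z A) u = (\<Sum>i<N. sign_vec A i * cnj (proj_off N k e u i))" for A u
    unfolding z_def ip_proj_off_right[symmetric] by (simp add: ip_def)
  have second: "(\<Sum>A\<in>?\<Omega>. (norm (ip N (z A) u))\<^sup>2) = 2 ^ N * sqnorm N (proj_off N k e u)" for u
    unfolding ipz sign_second_moment by (simp add: sqnorm_def)
  have fourth: "(\<Sum>A\<in>?\<Omega>. (norm (ip N (z A) u)) ^ 4) \<le> 2 ^ N * (3 * (sqnorm N u)\<^sup>2)" for u
  proof -
    have "(\<Sum>A\<in>?\<Omega>. (norm (ip N (z A) u)) ^ 4)
        \<le> 2 ^ N * (3 * (\<Sum>i<N. (norm (cnj (proj_off N k e u i)))\<^sup>2)\<^sup>2)"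
      unfolding ipz by (rule sign_fourth_moment)
    also have "(\<Sum>i<N. (norm (cnj (proj_off N k e u i)))\<^sup>2) = sqnorm N (proj_off N k e u)"
      by (rule sqnorm_cnj)
    also have "2 ^ N * (3 * (sqnorm N (proj_off N k e u))\<^sup>2) \<le> 2 ^ N * (3 * (sqnorm N u)\<^sup>2)"
      by (intro mult_left_mono power_mono sqnorm_proj_off_le[OF e] sqnorm_nonneg) auto
    finally show ?thesis .
  qed
  have "(\<Sum>A\<in>?\<Omega>. sqnorm N (z A)) = 2 ^ N * (real N - real k)"
  proof -
    have one: "sqnorm N (e b) = 1" if "b < k" for b
    proof -
      have "complex_of_real (sqnorm N (e b)) = 1"
        using e that ip_self[of N "e b"] by (simp add: orthonormal_def)
      thus ?thesis by (metis of_real_eq_1_iff)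
    qed
    have "(\<Sum>A\<in>?\<Omega>. (norm (ip N (sign_vec A) (e b)))\<^sup>2) = 2 ^ N" if "b < k" for b
      unfolding ip_def sign_second_moment sqnorm_cnj one[OF that] by simp
    hence "(\<Sum>A\<in>?\<Omega>. \<Sum>b<k. (norm (ip N (sign_vec A) (e b)))\<^sup>2) = 2 ^ N * real k"
      by (subst sum.swap) simp
    thus ?thesis
      by (simp add: z_def sqnorm_proj_off[OF e] sum_subtractf sqnorm_sign_vec card_Pow algebra_simps)
  qed
  moreover have "(\<Sum>A\<in>?\<Omega>. \<Sum>i<N. (x A i)\<^sup>2) \<le> 2 ^ N * (3 * real N)"
  proof -
    have "(\<Sum>A\<in>?\<Omega>. \<Sum>i<N. (x A i)\<^sup>2)
        = (\<Sum>i<N. (\<Sum>A\<in>?\<Omega>. (norm (ip N (z A) (fourier N i))) ^ 4) / (real N)\<^sup>2)"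
      by (subst sum.swap) (simp add: x_def power_divide sum_divide_distrib flip: power_mult)
    also have "\<dots> \<le> (\<Sum>i<N. (2 ^ N * (3 * (real N)\<^sup>2)) / (real N)\<^sup>2)"
      using fourth[of "fourier N _"] by (intro sum_mono divide_right_mono) (auto simp: sqnorm_fourier)
    also have "\<dots> = 2 ^ N * (3 * real N)" using N by simp
    finally show ?thesis .
  qed
  moreover have "\<beta> * (\<Sum>A\<in>?\<Omega>. Q A) \<le> 2 ^ N * (real N / 8)"
  proof -
    have "(\<Sum>A\<in>?\<Omega>. Q A) = (\<Sum>g\<in>G. 2 ^ N * sqnorm N (proj_off N k e (v g)))"
      unfolding Q_def by (subst sum.swap) (simp add: second)
    also have "\<dots> \<le> (\<Sum>g\<in>G. 2 ^ N * \<rho>\<^sup>2)"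
      using v by (intro sum_mono mult_left_mono) auto
    finally have "\<beta> * (\<Sum>A\<in>?\<Omega>. Q A) \<le> \<beta> * (\<Sum>g\<in>G. 2 ^ N * \<rho>\<^sup>2)"
      using \<beta> by (intro mult_left_mono) auto
    also have "\<dots> = 2 ^ N * (real N / 8)" using cG \<rho> by (simp add: \<beta>_def)
    finally show ?thesis .
  qed
  moreover have "(\<Sum>A\<in>?\<Omega>. F A) = (\<Sum>A\<in>?\<Omega>. sqnorm N (z A)) - (\<Sum>A\<in>?\<Omega>. \<Sum>i<N. (x A i)\<^sup>2) / 8
      - \<beta> * (\<Sum>A\<in>?\<Omega>. Q A)"
    by (simp add: F_def sum_subtractf sum_divide_distrib sum_distrib_left)
  ultimately have "(\<Sum>A\<in>?\<Omega>. F A) \<ge> 2 ^ N * (real N - real k) - 2 ^ N * (3 * real N) / 8 - 2 ^ N * (real N / 8)"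
    by linarith
  also have "2 ^ N * (real N - real k) - 2 ^ N * (3 * real N) / 8 - 2 ^ N * (real N / 8)
      = 2 ^ N * (real N / 2 - real k)" by (simp add: field_simps)
  finally have "2 ^ N * (real N / 2 - real k) \<le> (\<Sum>A\<in>?\<Omega>. F A)" .
  moreover have "2 ^ N * (3 * real N / 8) \<le> 2 ^ N * (real N / 2 - real k)"
    using k by (intro mult_left_mono) auto
  moreover have "(\<Sum>A\<in>?\<Omega>. 3 * real N / 8) = 2 ^ N * (3 * real N / 8)"
    by (simp add: card_Pow)
  ultimately have sumF: "(\<Sum>A\<in>?\<Omega>. 3 * real N / 8) \<le> (\<Sum>A\<in>?\<Omega>. F A)"
    by linarith
  have "\<exists>A\<in>?\<Omega>. 3 * real N / 8 \<le> F A"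
  proof (rule ccontr)
    assume "\<not> ?thesis"
    hence "F A < 3 * real N / 8" if "A \<in> ?\<Omega>" for A using that by (meson not_le)
    hence "(\<Sum>A\<in>?\<Omega>. F A) < (\<Sum>A\<in>?\<Omega>. 3 * real N / 8)"
      by (rule sum_strict_mono[rotated 2]) auto
    with sumF show False by simp
  qed
  then obtain A where A: "3 * real N / 8 \<le> F A" by blast
  have zN: "sqnorm N (z A) \<le> real N"
    using sqnorm_proj_off_le[OF e, of "sign_vec A"] by (simp add: z_def sqnorm_sign_vec)
  have xsum: "(\<Sum>i<N. x A i) = sqnorm N (z A)"
    using parseval[OF N, of "z A"] N by (simp add: x_def flip: sum_divide_distrib)
  have Q0: "0 \<le> Q A" by (simp add: Q_def sum_nonneg)
  have x0: "0 \<le> (\<Sum>i<N. (x A i)\<^sup>2)" by (simp add: sum_nonneg)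
  have "\<beta> * Q A \<le> real N" using A zN x0 unfolding F_def by linarith
  hence "Q A \<le> 8 * \<rho>\<^sup>2 * real (card G)"
    using N \<rho> cG by (simp add: \<beta>_def field_simps)
  moreover have "N \<le> 8 * card {i. i < N \<and> real N \<le> 8 * (norm (ip N (z A) (fourier N i)))\<^sup>2}"
  proof -
    define I where "I = {i. i < N \<and> real N \<le> 8 * (norm (ip N (z A) (fourier N i)))\<^sup>2}"
    have I: "I \<subseteq> {..<N}" by (auto simp: I_def)
    have "3 * real N / 8 \<le> (\<Sum>i<N. x A i - (x A i)\<^sup>2 / 8)"
      using A \<beta> Q0 mult_nonneg_nonneg[of \<beta> "Q A"]
      unfolding F_def sum_subtractf xsum sum_divide_distrib[symmetric] by linarith
    \<comment> \<open>The function \<open>x - x\<^sup>2 / 8\<close> has maximum 2, attained at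
      \<open>x = 4\<close>, and stays below \<open>1 / 8\<close> off \<open>I\<close>; hence
      \<open>3N/8 \<le> 2 * card I + N/8\<close>.\<close>
    also have "\<dots> \<le> (\<Sum>i<N. (if i \<in> I then 2 else 0) + 1 / 8)"
    proof (rule sum_mono)
      fix i assume i: "i \<in> {..<N}"
      show "x A i - (x A i)\<^sup>2 / 8 \<le> (if i \<in> I then 2 else 0) + 1 / 8"
      proof (cases "i \<in> I")
        case True
        have "0 \<le> (x A i - 4)\<^sup>2" by simp
        thus ?thesis using True by (simp add: power2_eq_square algebra_simps)
      next
        case False
        hence "8 * (norm (ip N (z A) (fourier N i)))\<^sup>2 < real N" using i by (simp add: I_def)
        hence "x A i < 1 / 8" using N by (simp add: x_def field_simps)
        hence "x A i - (x A i)\<^sup>2 / 8 \<le> 0 + 1 / 8" using zero_le_power2[of "x A i"] by linarith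
        thus ?thesis using False by simp
      qed
    qed
    also have "\<dots> = 2 * real (card I) + real N / 8"
      using I by (simp add: sum.distrib Int_absorb1 flip: sum.inter_restrict)
    finally have "real N \<le> real (8 * card I)" by simp
    thus ?thesis unfolding I_def by linarith
  qed
  ultimately show ?thesis using that unfolding Q_def by blast
qed

section \<open>Lower bound\<close>

text \<open>The starting volume is 1: minors of the coordinate rows of an orthonormal frame are at
  most 1. The zero row enters as a trivial combination.\<close>

lemma volbound_coordinates:
  assumes "orthonormal N m e" "N > 0"
  shows "volbound m (insert (\<lambda>_. 0) ((\<lambda>l b. e b l) ` {..<N})) 1"
proof -
  let ?X = "(\<lambda>l b. e b l) ` {..<N}"
  have vol: "volbound m ?X 1"
    unfolding volbound_def
  proof (intro allI impI)
    fix f assume "\<forall>a<m. f a \<in> ?X"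
    hence "\<forall>a\<in>{..<m}. \<exists>l. l < N \<and> f a = (\<lambda>b. e b l)" by auto
    then obtain l where "\<forall>a\<in>{..<m}. l a < N \<and> f a = (\<lambda>b. e b (l a))" by (rule exE[OF bchoice])
    moreover from this have "minor_det m f = minor_det m (\<lambda>a b. e b (l a))"
      by (intro minor_det_cong) simp
    ultimately show "norm (minor_det m f) \<le> 1"
      using norm_minor_det_le_1[OF assms(1), of l] by simp
  qed
  have "(\<lambda>b. e b 0) \<in> ?X" using assms(2) by auto
  from volbound_insert_combination[OF vol this this, of 0 0 1] show ?thesis by simp
qed

section \<open>Circulant matrices and the size inequality\<close>

lemma sum_shift_mod:
  fixes f :: "nat \<Rightarrow> 'a :: comm_monoid_add"
  assumes "N \<le> k"
  shows "(\<Sum>i\<in>{1..N}. f ((k - i) mod N)) = (\<Sum>r<N. f r)"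
proof -
  let ?g = "\<lambda>i. (k - i) mod N"
  have "i = j" if "i \<in> {1..N}" "j \<in> {1..N}" "?g i = ?g j" "i \<le> j" for i j
  proof -
    have "N dvd (k - i) - (k - j)"
      using that assms by (subst mod_eq_dvd_iff_nat[symmetric]) auto
    hence "N dvd j - i" using that assms by simp
    moreover have "j - i < N" using that by auto
    ultimately show "i = j" using that(4) by (auto dest: dvd_imp_le)
  qed
  hence inj: "inj_on ?g {1..N}"
    by (intro inj_onI) (metis nat_le_linear)
  have "?g ` {1..N} = {..<N}"
  proof (rule card_subset_eq)
    show "?g ` {1..N} \<subseteq> {..<N}" by auto
    show "card (?g ` {1..N}) = card {..<N}" using card_image[OF inj] by simp
  qed simp
  thus ?thesis using sum.reindex[OF inj, of f] by simp
qed

text \<open>Characters are eigenvectors of the circulant matrix of \<open>z\<close>, with eigenvalue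
  \<open>ip N z (fourier N h)\<close>.\<close>

lemma cyclic_convolution_fourier:
  assumes "N > 0" "N \<le> k"
  shows "(\<Sum>i\<in>{1..N}. z ((k - i) mod N) * fourier N h (i mod N)) = fourier N h k * ip N z (fourier N h)"
proof -
  have "fourier N h (i mod N) = fourier N h k * cnj (fourier N h ((k - i) mod N))"
    if "i \<in> {1..N}" for i
  proof -
    have "fourier N h k = fourier N h (k - i) * fourier N h i"
      using that assms(2) by (simp flip: fourier_add)
    thus ?thesis
      using fourier_mult_cnj[of N h "k - i"] assms(1) by (simp add: fourier_mod mult_ac)
  qed
  hence "(\<Sum>i\<in>{1..N}. z ((k - i) mod N) * fourier N h (i mod N))
      = (\<Sum>i\<in>{1..N}. fourier N h k * (z ((k - i) mod N) * cnj (fourier N h ((k - i) mod N))))"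
    by (intro sum.cong refl) (simp add: mult_ac)
  also have "\<dots> = fourier N h k * ip N z (fourier N h)"
    unfolding ip_def sum_distrib_left[symmetric]
    by (subst sum_shift_mod[OF assms(2), of "\<lambda>r. z r * cnj (fourier N h r)"]) simp
  finally show ?thesis .
qed

lemma mul_left_cases: "mul_left n P i = (\<lambda>_. 0) \<or>
    (\<exists>u. u \<in> operands (P ! i) \<and> mul_left n P i = lin n P u)"
  by (cases "P ! i") (auto simp: mul_left_def fun_eq_iff)

lemma mul_right_cases: "mul_right n P i = (\<lambda>_. 0) \<or>
    (\<exists>u. u \<in> operands (P ! i) \<and> mul_right n P i = lin n P u)"
  by (cases "P ! i") (auto simp: mul_right_def fun_eq_iff)

text \<open>Both sides bound the square of one output minor. The parameter \<open>t\<close> counts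
  instructions per row, so \<open>a ^ length P\<close> becomes
  \<open>(a powr t) ^ m\<close>.\<close>

lemma circuit_size_inequality:
  assumes circ: "circuit n P" and bc: "bounded_coefficient P"
    and comp: "computes n P (inverse_coeff n ` {1..n})"
    and m: "m > 0" "16 * m \<le> n" and S: "length P > 0"
  defines "t \<equiv> real (length P) / real m"
  shows "fact m / 2 ^ m \<le> (16 powr t * (1 + 128 * (4 powr t * t))) ^ m"
proof -
  define S where "S = length P"
  \<comment> \<open>The factor 8 makes \<open>k < m\<close> directions admissible in
    \<open>well_spread_point\<close> and yields \<open>N / 8 = m\<close> good frequencies;
    \<open>2 * N \<le> n\<close> keeps the required outputs available.\<close>
  define N where "N = 8 * m"
  \<comment> \<open>\<open>X\<close> extends periodically, while \<open>Y\<close> places a vector on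
    \<open>{1..N}\<close>; in both, position \<open>N\<close> holds coordinate 0.\<close>
  define X where "X z i = z (i mod N)" for z :: "nat \<Rightarrow> complex" and i :: nat
  define Y where "Y z i = (if i \<in> {1..N} then z (i mod N) else 0)" for z :: "nat \<Rightarrow> complex" and i :: nat
  \<comment> \<open>The factor 2 makes \<open>2 ^ S < \<rho> ^ m\<close> strict, as
    \<open>gram_schmidt_selection\<close> demands.\<close>
  define \<rho> where "\<rho> = 2 * 2 powr t"
  define X0 where "X0 e = insert (\<lambda>_. 0) ((\<lambda>l b. e b l) ` {..<N})" for e :: "nat \<Rightarrow> nat \<Rightarrow> complex"
  have N: "N > 0" "2 * N \<le> n" using m by (auto simp: N_def)
  have powS: "(a powr t) ^ m = a ^ S" if "a > 0" for a :: real
  proof -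
    have "(a powr t) ^ m = (a powr t) powr real m" using that by (simp add: powr_realpow)
    also have "\<dots> = a powr real S" using m by (simp add: powr_powr t_def S_def)
    finally show ?thesis using that by (simp add: powr_realpow)
  qed
  have four: "(4 :: real) ^ S = 2 ^ S * 2 ^ S"
    by (simp flip: power_mult_distrib)
  have \<rho>: "\<rho> > 0" by (simp add: \<rho>_def)
  have \<rho>m: "2 ^ S < \<rho> ^ m"
    using m by (simp add: \<rho>_def power_mult_distrib powS one_less_power)
  \<comment> \<open>The vector representing the functional \<open>z \<mapsto> L (X z)\<close>,
    conjugated because \<open>ip\<close> conjugates its second argument. The zero form in
    \<open>U\<close> covers instructions that are not multiplications.\<close>
  define form where "form L l = cnj (L (X (\<lambda>r. if r = l then 1 else 0)))" for L :: "(nat \<Rightarrow> complex) \<Rightarrow> complex" and l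
  define U where "U = insert (form (\<lambda>_. 0)) ((\<lambda>j. form (lin n P j)) ` {..<n + S})"
  have ip_lin: "ip N z (form (lin n P j)) = lin n P j (X z)" if "j < n + S" for z j
  proof -
    have "X z = (\<lambda>i. \<Sum>l<N. z l * X (\<lambda>r. if r = l then 1 else 0) i)"
      using N by (auto simp: X_def fun_eq_iff if_distrib cong: if_cong)
    hence "lin n P j (X z) = lin n P j (\<lambda>i. \<Sum>l<N. z l * X (\<lambda>r. if r = l then 1 else 0) i)"
      by (rule arg_cong)
    also have "\<dots> = (\<Sum>l<N. z l * lin n P j (X (\<lambda>r. if r = l then 1 else 0)))"
      by (rule lin_sum[OF circ]) (use that in \<open>simp add: S_def\<close>)
    finally have "lin n P j (X z) = (\<Sum>l<N. z l * lin n P j (X (\<lambda>r. if r = l then 1 else 0)))" .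
    thus ?thesis by (simp add: ip_def form_def)
  qed
  have vol_lin: "volbound m (X0 e \<union> (\<lambda>j b. lin n P j (E b)) ` {..<n + S}) (2 ^ S)"
    if "orthonormal N m e" "\<And>j. j < n \<Longrightarrow> (\<lambda>b. E b (Suc j)) \<in> X0 e" for e E
    using volbound_lin[OF circ bc volbound_coordinates[OF that(1) N(1)], of E] that(2)
    by (simp add: X0_def S_def)
  have vol_U: "norm (minor_det m (\<lambda>a b. ip N (e b) (u a))) \<le> 2 ^ S"
    if e: "orthonormal N m e" and u: "\<And>a. a < m \<Longrightarrow> u a \<in> U" for e u
  proof -
    have "(\<lambda>b. X (e b) (Suc j)) \<in> X0 e" for j
      using N by (auto simp: X_def X0_def)
    hence "volbound m (X0 e \<union> (\<lambda>j b. lin n P j (X (e b))) ` {..<n + S}) (2 ^ S)"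
      by (intro vol_lin e)
    moreover have "(\<lambda>b. ip N (e b) (u a)) \<in> X0 e \<union> (\<lambda>j b. lin n P j (X (e b))) ` {..<n + S}"
      if "a < m" for a
    proof -
      have "u a = form (\<lambda>_. 0) \<or> (\<exists>j<n + S. u a = form (lin n P j))"
        using u[OF that] by (auto simp: U_def)
      thus ?thesis
      proof
        assume "u a = form (\<lambda>_. 0)"
        thus ?thesis by (simp add: ip_def form_def X0_def)
      next
        assume "\<exists>j<n + S. u a = form (lin n P j)"
        thus ?thesis by (auto simp: ip_lin)
      qed
    qed
    ultimately show ?thesis by (rule volboundD)
  qed
  obtain k e where k: "k < m" and e: "orthonormal N k e"
    and short: "\<And>u. u \<in> U \<Longrightarrow> sqnorm N (proj_off N k e u) \<le> \<rho>\<^sup>2"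
    using gram_schmidt_selection[OF vol_U less_imp_le[OF \<rho>] \<rho>m] by metis
  have opS: "u < n + S" if "i < S" "u \<in> operands (P ! i)" for i u
    using operand_less[OF circ] that by (simp add: S_def)
  have left_U: "form (mul_left n P i) \<in> U" and ip_left: "ip N z (form (mul_left n P i)) = mul_left n P i (X z)"
    and left_row: "(\<lambda>b. mul_left n P i (E b)) \<in> X0 e \<union> (\<lambda>j b. lin n P j (E b)) ` {..<n + S}"
    if "i < S" for i z E e
    using mul_left_cases[of n P i] opS[OF that] ip_lin by (auto simp: U_def X0_def ip_def form_def)
  have right_U: "form (mul_right n P i) \<in> U" and ip_right: "ip N z (form (mul_right n P i)) = mul_right n P i (X z)"
    and right_row: "(\<lambda>b. mul_right n P i (E b)) \<in> X0 e \<union> (\<lambda>j b. lin n P j (E b)) ` {..<n + S}"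
    if "i < S" for i z E e
    using mul_right_cases[of n P i] opS[OF that] ip_lin by (auto simp: U_def X0_def ip_def form_def)
  \<comment> \<open>Left and right factors are indexed by a disjoint sum, so one point
    \<open>z\<close> controls all \<open>2 * S\<close> forms.\<close>
  define w where "w = case_sum (\<lambda>i. form (mul_left n P i)) (\<lambda>i. form (mul_right n P i))"
  have "sqnorm N (proj_off N k e (w g)) \<le> \<rho>\<^sup>2" if "g \<in> {..<S} <+> {..<S}" for g
    using that left_U right_U by (auto simp: w_def intro!: short)
  moreover have "8 * k \<le> N" "{..<S} <+> {..<S} \<noteq> {}" using k assms(6) by (auto simp: N_def S_def)
  ultimately obtain z where z: "(\<Sum>g\<in>{..<S} <+> {..<S}. (norm (ip N z (w g)))\<^sup>2)
        \<le> 8 * \<rho>\<^sup>2 * real (card ({..<S} <+> {..<S}))"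
      "N \<le> 8 * card {i. i < N \<and> real N \<le> 8 * (norm (ip N z (fourier N i)))\<^sup>2}"
    using well_spread_point[OF N(1) e _ _ _ \<rho>, of "{..<S} <+> {..<S}" w] by auto
  let ?l = "\<lambda>i. mul_left n P i (X z)" and ?r = "\<lambda>i. mul_right n P i (X z)"
  have "(\<Sum>i<S. (norm (?l i) + norm (?r i))\<^sup>2) \<le> (\<Sum>i<S. 2 * ((norm (?l i))\<^sup>2 + (norm (?r i))\<^sup>2))"
  proof (rule sum_mono)
    fix i
    have "0 \<le> (norm (?l i) - norm (?r i))\<^sup>2" by simp
    thus "(norm (?l i) + norm (?r i))\<^sup>2 \<le> 2 * ((norm (?l i))\<^sup>2 + (norm (?r i))\<^sup>2)"
      by (simp add: power2_eq_square algebra_simps)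
  qed
  also have "\<dots> = 2 * (\<Sum>g\<in>{..<S} <+> {..<S}. (norm (ip N z (w g)))\<^sup>2)"
    by (simp add: sum.Plus w_def ip_left ip_right sum.distrib flip: sum_distrib_left)
  also have "\<dots> \<le> 2 * (8 * \<rho>\<^sup>2 * real (card ({..<S} <+> {..<S})))"
    using z(1) by simp
  \<comment> \<open>The constant is \<open>2 * 8 * 4 * 2\<close>, with \<open>4 * 4 powr t\<close>
    from \<open>\<rho>\<^sup>2\<close> and \<open>2 * S\<close> forms.\<close>
  also have "\<dots> = real m * (128 * (4 powr t * t))"
  proof -
    have "\<rho>\<^sup>2 = 4 * 4 powr t"
      by (simp add: \<rho>_def power_mult_distrib powr_powr powr_mult[of 2 2, simplified] power2_eq_square
          flip: powr_add)
    moreover have "real S = real m * t" using m by (simp add: t_def S_def)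
    ultimately show ?thesis by (simp add: card_Plus)
  qed
  finally have weights: "(\<Sum>i<S. (norm (?l i) + norm (?r i))\<^sup>2) \<le> real m * (128 * (4 powr t * t))" .
  define L where "L = 1 + 128 * (4 powr t * t)"
  have L: "L > 0" unfolding L_def by (simp add: t_def add_pos_nonneg)

  define I0 where "I0 = {i. i < N \<and> real N \<le> 8 * (norm (ip N z (fourier N i)))\<^sup>2}"
  have "m \<le> card I0" using z(2) by (simp add: I0_def N_def)
  then obtain I where I: "I \<subseteq> I0" "card I = m" "finite I" by (rule obtain_subset_with_card_n)
  obtain h where "bij_betw h {0..<m} I"
    using ex_bij_betw_nat_finite[OF I(3)] I(2) by auto
  hence h: "inj_on h {..<m}" "\<And>b. b < m \<Longrightarrow> h b \<in> I0"
    using I(1) by (auto simp: bij_betw_def atLeast0LessThan)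
  define e' where "e' b l = complex_of_real (1 / sqrt (real N)) * fourier N (h b) l" for b l
  define E where "E b = Y (e' b)" for b
  have sqrtN: "complex_of_real (sqrt (real N)) * complex_of_real (sqrt (real N)) = of_nat N"
    by (simp flip: of_real_mult)
  have orth: "orthonormal N m e'"
    unfolding orthonormal_def
  proof (intro allI impI)
    fix a b assume ab: "a < m" "b < m"
    have "ip N (e' a) (e' b) = ip N (fourier N (h a)) (fourier N (h b)) / of_nat N"
      unfolding e'_def ip_scale_left ip_scale_right using sqrtN by (simp add: field_simps)
    also have "\<dots> = (if a = b then 1 else 0)"
      using ab h N by (auto simp: fourier_orthogonal I0_def inj_on_def)
    finally show "ip N (e' a) (e' b) = (if a = b then 1 else 0)" .
  qed
  have "(\<lambda>b. E b (Suc j)) \<in> X0 e'" for j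
    using N by (cases "Suc j \<le> N") (auto simp: E_def Y_def X0_def)
  hence "volbound m (X0 e' \<union> (\<lambda>j b. lin n P j (E b)) ` {..<n + S}) (2 ^ S)"
    by (intro vol_lin orth)
  define X1 where "X1 = X0 e' \<union> (\<lambda>j b. lin n P j (E b)) ` {..<n + S}"
  have zero: "(\<lambda>_. 0) \<in> X1" by (simp add: X1_def X0_def)
  have "volbound m X1 (2 ^ S)" unfolding X1_def by fact
  \<comment> \<open>The bound accumulates \<open>2 ^ S\<close> from the linear parts,
    \<open>sqrt L ^ m\<close> from all products together and, next, another \<open>2 ^ S\<close>
    from the bilinear parts.\<close>
  hence "volbound m (X1 \<union> mul_row n P (X z) E ` {..<S}) (2 ^ S * sqrt L ^ m)"
    using weights m zero left_row[of _ E e'] right_row[of _ E e']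
    unfolding mul_row_def[abs_def]
    by (intro volbound_products) (auto simp: X1_def L_def algebra_simps)
  hence "volbound m ((X1 \<union> mul_row n P (X z) E ` {..<S}) \<union> (\<lambda>j b. bil n P j (X z) (E b)) ` {..<n + S})
      (2 ^ S * (2 ^ S * sqrt L ^ m))"
    unfolding S_def by (intro volbound_bil circ bc) (use zero in auto)
  hence vol: "volbound m ((\<lambda>j b. bil n P j (X z) (E b)) ` {..<n + S}) (4 ^ S * sqrt L ^ m)"
    by (rule volbound_mono) (auto simp: four mult.assoc)

  obtain l where l: "\<And>a. a < m \<Longrightarrow> l a < N"
    "fact m \<le> real N ^ m * (norm (minor_det m (\<lambda>a b. e' b (l a))))\<^sup>2"
    using large_minor_det[OF orth] by metis
  define \<mu> where "\<mu> b = 2 * ip N z (fourier N (h b))" for b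
  have out: "\<exists>j<n + S. \<forall>b. bil n P j (X z) (E b) = \<mu> b * e' b (l a)" if "a < m" for a
  proof -
    \<comment> \<open>The representative of the residue \<open>l a\<close> in
      \<open>{N<..2 * N}\<close>. For \<open>k > N\<close> the convolution covers the whole support
      \<open>{1..N}\<close> of \<open>E b\<close>.\<close>
    define k where "k = (if l a = 0 then 2 * N else N + l a)"
    have k: "N < k" "k \<le> 2 * N" "k mod N = l a"
      using l(1)[OF that] N by (auto simp: k_def)
    have "k \<in> {1..n}" using k N by auto
    from output_bil[OF circ comp this] obtain j where j: "j < n + S"
      "\<And>x y. bil n P j x y = 2 * (\<Sum>i\<in>{1..<k}. x (k - i) * y i)" unfolding S_def by metis
    have "bil n P j (X z) (E b) = \<mu> b * e' b (l a)" for b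
    proof -
      have "(\<Sum>i\<in>{1..<k}. X z (k - i) * E b i) = (\<Sum>i\<in>{1..N}. z ((k - i) mod N) * e' b (i mod N))"
        using k by (intro sum.mono_neutral_cong_right) (auto simp: X_def E_def Y_def)
      also have "\<dots> = complex_of_real (1 / sqrt (real N))
          * (\<Sum>i\<in>{1..N}. z ((k - i) mod N) * fourier N (h b) (i mod N))"
        by (simp add: e'_def sum_distrib_left mult_ac)
      also have "\<dots> = ip N z (fourier N (h b)) * e' b (l a)"
        using cyclic_convolution_fourier[OF N(1) less_imp_le[OF k(1)], of z "h b"]
        by (simp add: e'_def fourier_mod[OF N(1), of _ k] flip: k(3))
      finally show ?thesis by (simp add: j(2) \<mu>_def)
    qed
    with j(1) show ?thesis by blast
  qed
  have "(\<lambda>b. \<mu> b * e' b (l a)) \<in> (\<lambda>j b. bil n P j (X z) (E b)) ` {..<n + S}" if a: "a < m" for a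
  proof -
    obtain j where "j < n + S" "\<And>b. bil n P j (X z) (E b) = \<mu> b * e' b (l a)"
      using out[OF a] by blast
    thus ?thesis by (intro image_eqI[of _ _ j]) auto
  qed
  hence "norm (minor_det m (\<lambda>a b. \<mu> b * e' b (l a))) \<le> 4 ^ S * sqrt L ^ m"
    by (intro volboundD[OF vol])
  hence "(norm (minor_det m (\<lambda>a b. \<mu> b * e' b (l a))))\<^sup>2 \<le> (4 ^ S * sqrt L ^ m)\<^sup>2"
    by (intro power_mono) auto
  also have "\<dots> = 16 ^ S * L ^ m"
  proof -
    have "(sqrt L ^ m)\<^sup>2 = ((sqrt L)\<^sup>2) ^ m"
      by (simp only: power_mult[symmetric] mult.commute)
    hence "(sqrt L ^ m)\<^sup>2 = L ^ m" using L by simp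
    moreover have "((4::real) ^ S)\<^sup>2 = 16 ^ S" by (simp add: power2_eq_square flip: power_mult_distrib)
    ultimately show ?thesis by (simp add: power_mult_distrib)
  qed
  finally have upper: "(norm (minor_det m (\<lambda>a b. \<mu> b * e' b (l a))))\<^sup>2 \<le> 16 ^ S * L ^ m" .
  let ?d = "(norm (minor_det m (\<lambda>a b. e' b (l a))))\<^sup>2"
  have "fact m / 2 ^ m \<le> real N ^ m * ?d / 2 ^ m"
    using l(2) by (intro divide_right_mono) auto
  also have "\<dots> = (\<Prod>b<m. real N / 2) * ?d"
    by (simp add: power_divide)
  \<comment> \<open>Each selected frequency satisfies
    \<open>(norm (\<mu> b))\<^sup>2 \<ge> N / 2\<close>, since \<mu> carries the factor 2 of the
    polarisation.\<close>
  also have "\<dots> \<le> (\<Prod>b<m. (norm (\<mu> b))\<^sup>2) * ?d"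
    using h(2) by (intro mult_right_mono prod_mono) (auto simp: \<mu>_def norm_mult power_mult_distrib I0_def)
  also have "\<dots> = (norm (minor_det m (\<lambda>a b. \<mu> b * e' b (l a))))\<^sup>2"
    unfolding minor_det_scale_columns norm_mult power_mult_distrib
    by (simp add: prod_norm[symmetric] prod_power_distrib)
  also note upper
  also have "16 ^ S * L ^ m = (16 powr t * (1 + 128 * (4 powr t * t))) ^ m"
    by (simp add: power_mult_distrib powS L_def)
  finally show ?thesis .
qed

text \<open>The term with index \<open>m\<close> in the series of \<open>exp m\<close> is at most
  the whole sum, and \<open>exp 1 \<le> 3\<close>.\<close>

lemma self_power_le_fact: "real m ^ m \<le> 3 ^ m * fact m"
proof -
  have "real m ^ m /\<^sub>R fact m = (\<Sum>k\<in>{m}. real m ^ k /\<^sub>R fact k)" by simp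
  also have "\<dots> \<le> (\<Sum>k. real m ^ k /\<^sub>R fact k)"
    by (rule sum_le_suminf[OF summable_exp_generic]) auto
  also have "\<dots> = exp (real m * 1)" by (simp add: exp_def)
  also have "\<dots> = exp 1 ^ m" by (rule exp_of_nat_mult)
  also have "\<dots> \<le> 3 ^ m" by (rule power_mono[OF exp_le]) simp
  finally show ?thesis by (simp add: field_simps)
qed

section \<open>Existence of optimal circuits\<close>

text \<open>Some circuit has to exist, for otherwise the \<open>LEAST\<close> in
  \<open>bc_complexity\<close> says nothing about circuits.\<close>

definition computable :: "nat \<Rightarrow> cfun set \<Rightarrow> bool" where
  "computable n V \<longleftrightarrow> (\<exists>P. circuit n P \<and> bounded_coefficient P \<and> computes n P V)"

lemma computable_subset: "computable n V \<Longrightarrow> W \<subseteq> V \<Longrightarrow> computable n W"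
  unfolding computable_def computes_def by blast

lemma computable_insert:
  assumes "computable n V" "u \<in> V" "v \<in> V"
  shows "computable n (insert (\<lambda>a. u a + v a) V)" "computable n (insert (\<lambda>a. u a * v a) V)"
proof -
  obtain P where P: "circuit n P" "bounded_coefficient P" "computes n P V"
    using assms(1) by (auto simp: computable_def)
  obtain i j where ij: "i < n + length P" "circuit_values n P ! i = u"
      "j < n + length P" "circuit_values n P ! j = v"
    using P(3) assms(2,3) by (auto simp: computes_def subset_iff in_set_conv_nth) metis
  have "circuit n (P @ [Add i j]) \<and> bounded_coefficient (P @ [Add i j])
      \<and> computes n (P @ [Add i j]) (insert (\<lambda>a. u a + v a) V)"
    using P ij by (auto simp: circuit_snoc bounded_coefficient_snoc computes_def circuit_values_snoc)
  thus "computable n (insert (\<lambda>a. u a + v a) V)" unfolding computable_def by blast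
  have "circuit n (P @ [Mul i j]) \<and> bounded_coefficient (P @ [Mul i j])
      \<and> computes n (P @ [Mul i j]) (insert (\<lambda>a. u a * v a) V)"
    using P ij by (auto simp: circuit_snoc bounded_coefficient_snoc computes_def circuit_values_snoc)
  thus "computable n (insert (\<lambda>a. u a * v a) V)" unfolding computable_def by blast
qed

lemma computable_inverse_coeff: "computable n (inverse_coeff n ` {1..n})"
proof -
  let ?A = "(\<lambda>i a. a i) ` {1..n} :: cfun set"
  have "computable n (?A \<union> inverse_coeff n ` {1..k})" if "k \<le> n" for k
    using that
  proof (induction k)
    case 0
    have "computes n [] ?A" by (auto simp: computes_def circuit_values_Nil)
    thus ?case by (auto simp: computable_def bounded_coefficient_def intro!: exI[of _ "[]"])
  next
    case (Suc k)
    let ?V = "?A \<union> inverse_coeff n ` {1..k}"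
    let ?s = "\<lambda>r a. a (Suc k) + (\<Sum>i\<in>{1..r}. a (Suc k - i) * inverse_coeff n i a)"
    have partial: "computable n (insert (?s r) ?V)" if "r \<le> k" for r
      using that
    proof (induction r)
      case 0
      have "?s 0 \<in> ?V" using Suc.prems by auto
      thus ?case using Suc by (simp add: insert_absorb del: Un_iff)
    next
      case (Suc r)
      let ?W = "insert (?s r) ?V"
      let ?x = "\<lambda>a. a (Suc k - Suc r) :: complex"
      let ?p = "\<lambda>a. ?x a * inverse_coeff n (Suc r) a"
      have "Suc k - Suc r \<in> {1..n}" using Suc.prems \<open>Suc k \<le> n\<close> by auto
      hence "?x \<in> ?A" by (rule rev_image_eqI) (rule refl)
      hence "?x \<in> ?W" "inverse_coeff n (Suc r) \<in> ?W"
        using Suc.prems by auto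
      hence "computable n (insert ?p ?W)"
        using Suc by (intro computable_insert(2)) auto
      hence "computable n (insert (\<lambda>a. ?s r a + ?p a) (insert ?p ?W))"
        by (rule computable_insert(1)) auto
      moreover have "(\<lambda>a. ?s r a + ?p a) = ?s (Suc r)"
        by (simp add: fun_eq_iff add.assoc)
      ultimately show ?case by (elim computable_subset) auto
    qed
    have "inverse_coeff n (Suc k) = ?s k"
    proof
      fix a
      have "inverse_coeff n (Suc k) a = (\<Sum>i<Suc k. a (Suc k - i) * inverse_coeff n i a)"
        using Suc.prems by (intro inverse_coeff_rec) auto
      also have "{..<Suc k} = insert 0 {1..k}" by auto
      finally show "inverse_coeff n (Suc k) a = ?s k a" by (simp add: inverse_coeff_0)
    qed
    with partial[of k] show ?case by (simp add: atLeastAtMostSuc_conv)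
  qed
  from this[OF order_refl] show ?thesis by (elim computable_subset) auto
qed

lemma optimal_circuit:
  obtains P where "circuit n P" "bounded_coefficient P" "computes n P (inverse_coeff n ` {1..n})"
    "length P = bc_complexity n (inverse_coeff n ` {1..n})"
proof -
  have "\<exists>s P. circuit n P \<and> bounded_coefficient P \<and> computes n P (inverse_coeff n ` {1..n}) \<and> length P = s"
    using computable_inverse_coeff[of n] by (auto simp: computable_def)
  from LeastI_ex[OF this] that show ?thesis unfolding bc_complexity_def by blast
qed

text \<open>Inputs have no quadratic part, whereas the second coefficient contains the square of the
  first variable.\<close>

lemma circuit_size_pos:
  assumes "circuit n P" "computes n P (inverse_coeff n ` {1..n})" "n \<ge> 2"
  shows "length P > 0"
proof (rule ccontr)
  assume "\<not> length P > 0"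
  hence P: "P = []" by simp
  obtain j where j: "j < n + length P" "\<And>x y. bil n P j x y = 2 * (\<Sum>i\<in>{1..<2}. x (2 - i) * y i)"
    using output_bil[OF assms(1,2), of 2] assms(3) by auto
  have "bil n P j (\<lambda>_. 1) (\<lambda>_. 1) = 0"
    using j(1) P by (simp add: bil_def quad_input)
  thus False by (simp add: j(2))
qed

section \<open>Asymptotics\<close>

text \<open>A smaller circuit would have \<open>t \<le> log 2 n / 19\<close>. After taking
  \<open>m\<close>-th roots, the size inequality would bound \<open>m / 6\<close> by order
  \<open>n powr (6 / 19) * log 2 n\<close>, although \<open>m\<close> is at least
  \<open>n / 17\<close>.\<close>

lemma circuit_size_eventually:
  "eventually (\<lambda>n. \<forall>P. circuit n P \<and> bounded_coefficient P \<and> computes n P (inverse_coeff n ` {1..n})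
    \<longrightarrow> 1 / 324 * real n * log 2 (real n) < real (length P)) at_top"
proof -
  \<comment> \<open>The 6 combines the 3 of \<open>self_power_le_fact\<close> with the 2 in
    \<open>fact m / 2 ^ m\<close>.\<close>
  have "eventually (\<lambda>n::nat. 6 * (real n powr (4 / 19) *
      (1 + 128 * (real n powr (2 / 19) * (log 2 (real n) / 19)))) < real n / 17) at_top"
    by real_asymp
  \<comment> \<open>From 255 on, \<open>n div 16\<close> is at least 15 and hence at least the
    remainder, so \<open>n \<le> 17 * m\<close>.\<close>
  thus ?thesis using eventually_ge_at_top[of 255]
  proof eventually_elim
    case (elim n)
    show ?case
    proof (intro allI impI, elim conjE, rule ccontr)
      fix P assume P: "circuit n P" "bounded_coefficient P" "computes n P (inverse_coeff n ` {1..n})"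
        and "\<not> 1 / 324 * real n * log 2 (real n) < real (length P)"
      hence le: "real (length P) \<le> 1 / 324 * real n * log 2 (real n)" by simp
      define m where "m = n div 16"
      define t where "t = real (length P) / real m"
      define R where "R = 16 powr t * (1 + 128 * (4 powr t * t))"
      have "16 * m + n mod 16 = n" "n mod 16 < 16" by (simp_all add: m_def)
      hence "17 * m \<ge> n" using elim(2) by linarith
      hence m: "m > 0" "16 * m \<le> n" "real n / 17 \<le> real m" using elim(2) by (auto simp: m_def)
      have t0: "t \<ge> 0" by (simp add: t_def)
      have log0: "log 2 (real n) \<ge> 0" using elim(2) by simp
      have t: "t \<le> log 2 (real n) / 19"
      proof -
        have "real (length P) \<le> 1 / 324 * (17 * real m) * log 2 (real n)"
          using le m(3) log0 by (elim order_trans, intro mult_mono) auto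
        \<comment> \<open>This is where the constant fits: \<open>17 * 19 = 323\<close> is below
          324.\<close>
        also have "\<dots> \<le> real m * (log 2 (real n) / 19)"
          using log0 by (simp add: mult_left_mono)
        finally show ?thesis using m(1) by (simp add: t_def field_simps)
      qed
      have R0: "0 \<le> R" using t0 by (simp add: R_def)
      have pow: "(2 powr c) powr t \<le> real n powr (c / 19)" if "c \<ge> 0" for c
      proof -
        have "(2 powr c) powr t = 2 powr (c * t)" by (simp add: powr_powr)
        also have "\<dots> \<le> 2 powr (log 2 (real n) * (c / 19))"
          using mult_left_mono[OF t that] by (simp add: mult_ac)
        also have "\<dots> = (2 powr log 2 (real n)) powr (c / 19)" by (simp add: powr_powr)
        also have "2 powr log 2 (real n) = real n" using elim(2) by simp
        finally show ?thesis .
      qed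
      have "R \<le> real n powr (4 / 19) * (1 + 128 * (real n powr (2 / 19) * (log 2 (real n) / 19)))"
        unfolding R_def using pow[of 4] pow[of 2] t t0 by (intro mult_mono add_mono) auto
      hence "6 * R < real n / 17" using elim(1) by linarith
      hence "6 * R < real m" using m(3) by linarith
      have "(real m / 6) ^ m = real m ^ m / 3 ^ m / 2 ^ m"
        by (simp add: power_divide flip: power_mult_distrib)
      also have "\<dots> \<le> fact m / 2 ^ m"
        using self_power_le_fact[of m] by (intro divide_right_mono) (simp_all add: field_simps)
      also have "\<dots> \<le> R ^ m"
        using circuit_size_inequality[OF P m(1,2) circuit_size_pos[OF P(1,3)]] elim(2)
        by (simp add: R_def t_def)
      finally have "(real m / 6) ^ m \<le> R ^ m" .
      moreover have "R ^ m < (real m / 6) ^ m"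
        using \<open>6 * R < real m\<close> R0 m(1) by (intro power_strict_mono) auto
      ultimately show False by simp
    qed
  qed
qed

theorem theorem5p2:
  "\<exists>C::real. \<forall>n\<ge>2.
     real (bc_complexity n (inverse_coeff n ` {1..n}))
       > 1 / 324 * real n * log 2 (real n) - C * (real n * log 2 (log 2 (real n)))"
proof -
  obtain n0 where n0: "\<And>n P. n \<ge> n0 \<Longrightarrow> circuit n P \<Longrightarrow> bounded_coefficient P \<Longrightarrow>
      computes n P (inverse_coeff n ` {1..n}) \<Longrightarrow> 1 / 324 * real n * log 2 (real n) < real (length P)"
    using circuit_size_eventually unfolding eventually_at_top_linorder by blast
  \<comment> \<open>For \<open>3 \<le> n < n0\<close> this gives \<open>log 2 n \<le> C\<close>, and
    the double logarithm is at least \<open>1 / 2\<close>, so the right-hand side of the claim is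
    negative.\<close>
  define C where "C = log 2 (real (n0 + 2))"
  have C0: "C > 0" by (simp add: C_def)
  show ?thesis
  proof (intro exI[of _ C] allI impI)
    fix n :: nat assume n: "n \<ge> 2"
    let ?b = "bc_complexity n (inverse_coeff n ` {1..n})"
    obtain P where P: "circuit n P" "bounded_coefficient P"
        "computes n P (inverse_coeff n ` {1..n})" "length P = ?b"
      by (rule optimal_circuit)
    show "1 / 324 * real n * log 2 (real n) - C * (real n * log 2 (log 2 (real n))) < real ?b"
    proof (cases "n = 2")
      \<comment> \<open>Here the double logarithm is 0, so the claim must follow from the size being
        at least 1.\<close>
      case True
      have "real ?b \<ge> 1" using circuit_size_pos[OF P(1,3) n] P(4) by simp
      thus ?thesis using True by simp
    next
      case False
      hence n3: "real n \<ge> 3" using n by simp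
      \<comment> \<open>Since \<open>2 powr (3 / 2) \<le> 3\<close>, the logarithm is at least
        \<open>3 / 2\<close>, which exceeds \<open>sqrt 2\<close>; so the double logarithm is at
        least \<open>1 / 2\<close>.\<close>
      have "log 2 (2 powr (3 / 2)) \<le> log 2 (real n)"
      proof (subst log_le_cancel_iff)
        have "2 powr (3 / 2) = 2 * sqrt (2::real)"
          using powr_add[of 2 1 "1 / 2 :: real"] by (simp add: powr_half_sqrt)
        also have "sqrt 2 \<le> 3 / 2" by (rule real_le_lsqrt) (auto simp: power2_eq_square)
        finally show "2 powr (3 / 2) \<le> real n" using n3 by simp
      qed (use n3 in auto)
      hence l: "log 2 (real n) \<ge> 3 / 2" by simp
      have "log 2 (2 powr (1 / 2)) \<le> log 2 (log 2 (real n))"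
      proof (subst log_le_cancel_iff)
        have "sqrt 2 \<le> 3 / (2::real)" by (rule real_le_lsqrt) (auto simp: power2_eq_square)
        thus "2 powr (1 / 2) \<le> log 2 (real n)" using l by (simp add: powr_half_sqrt)
      qed (use l in auto)
      hence ll: "log 2 (log 2 (real n)) \<ge> 1 / 2" by simp
      show ?thesis
      proof (cases "n \<ge> n0")
        case True
        have "0 \<le> C * (real n * log 2 (log 2 (real n)))"
          using C0 ll by simp
        thus ?thesis using n0[OF True P(1-3)] P(4) by linarith
      next
        case False
        have "log 2 (real n) \<le> C"
          unfolding C_def using False n by (intro log_mono) auto
        hence "real n * log 2 (real n) * (1 / 2) \<le> real n * C * log 2 (log 2 (real n))"
          using ll C0 by (intro mult_mono mult_left_mono) auto
        moreover have "real n * log 2 (real n) > 0" using l n3 by simp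
        ultimately have "1 / 324 * real n * log 2 (real n) - C * (real n * log 2 (log 2 (real n))) < 0"
          by (simp add: mult_ac)
        thus ?thesis by (rule order.strict_trans2) simp
      qed
    qed
  qed
qed

end
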